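(* For every nonempty set $\mathcal{D}$ of discounting functions, the validity problem for $\mathrm{LTL}^{\mathrm{disc}\oplus}[\mathcal{D}]$ is undecidable: there is no algorithm that, given an $\mathrm{LTL}^{\mathrm{disc}\oplus}[\mathcal{D}]$ formula $\varphi$ over atomic propositions $AP$ and a threshold $v\in[0,1]$, decides whether $[\![\pi,\varphi]\!]>v$ for every computation $\pi\in(2^{AP})^\omega$.
   Context: Let $AP$ be a finite set of atomic propositions. A computation is $\pi=\pi_0\pi_1\cdots\in(2^{AP})^\omega$, $\pi^i=\pi_i\pi_{i+1}\cdots$. A discounting function is a strictly decreasing $\eta:\mathbb{N}\to[0,1]$ with $\lim_{i\to\infty}\eta(i)=0$. For a set $\mathcal{D}$ of discounting functions, $\mathrm{LTL}^{\mathrm{disc}\oplus}[\mathcal{D}]$ formulas are given by $\varphi ::= \mathtt{True}\mid p\mid\neg\varphi\mid\varphi\vee\varphi\mid\mathsf{X}\varphi\mid\varphi\,\mathsf{U}\,\varphi\mid\varphi\,\mathsf{U}_\eta\,\varphi\mid\varphi\oplus\varphi$ ($p\in AP$, $\eta\in\mathcal{D}$), with values $[\![\pi,\varphi]\!]\in[0,1]$: $[\![\pi,\mathtt{True}]\!]=1$; $[\![\pi,p]\!]=1$ if $p\in\pi_0$, else $0$; $[\![\pi,\neg\varphi]\!]=1-[\![\pi,\varphi]\!]$; $[\![\pi,\varphi\vee\psi]\!]=\max\{[\![\pi,\varphi]\!],[\![\pi,\psi]\!]\}$; $[\![\pi,\mathsf{X}\varphi]\!]=[\![\pi^1,\varphi]\!]$;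 $[\![\pi,\varphi\,\mathsf{U}\,\psi]\!]=\sup_{i\ge0}\min\{[\![\pi^i,\psi]\!],\min_{0\le j<i}[\![\pi^j,\varphi]\!]\}$; $[\![\pi,\varphi\,\mathsf{U}_\eta\,\psi]\!]=\sup_{i\ge0}\min\{\eta(i)[\![\pi^i,\psi]\!],\min_{0\le j<i}\eta(j)[\![\pi^j,\varphi]\!]\}$; $[\![\pi,\varphi\oplus\psi]\!]=\frac{[\![\pi,\varphi]\!]+[\![\pi,\psi]\!]}{2}$. *)

theory Defs
  imports Complex_Main "HOL-Library.Nat_Bijection"
begin

definition discounting :: "(nat \<Rightarrow> real) \<Rightarrow> bool" where
  "discounting \<eta> \<longleftrightarrow> (\<forall>i j. i < j \<longrightarrow> \<eta> j < \<eta> i) \<and> (\<forall>i. 0 \<le> \<eta> i \<and> \<eta> i \<le> 1)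
     \<and> \<eta> \<longlonglongrightarrow> 0"

datatype form =
    FTrue
  | Prop nat
  | Neg form
  | Or form form
  | Next form
  | Until form form
  | DUntil nat form form   (* DUntil l a b : a U_eta b with eta = iota l *)
  | Avg form form

definition sfx :: "(nat \<Rightarrow> nat set) \<Rightarrow> nat \<Rightarrow> nat \<Rightarrow> nat set" where
  "sfx \<pi> i = (\<lambda>k. \<pi> (i + k))"

(* min over j < i of f j, with the empty minimum equal to 1 (all values involved are \<le> 1) *)
definition pmin :: "(nat \<Rightarrow> real) \<Rightarrow> nat \<Rightarrow> real" where
  "pmin f i = Min (insert 1 (f ` {..<i}))"

primrec val :: "(nat \<Rightarrow> nat \<Rightarrow> real) \<Rightarrow> form \<Rightarrow> (nat \<Rightarrow> nat set) \<Rightarrow> real" where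
  "val \<iota> FTrue \<pi> = 1"
| "val \<iota> (Prop p) \<pi> = (if p \<in> \<pi> 0 then 1 else 0)"
| "val \<iota> (Neg a) \<pi> = 1 - val \<iota> a \<pi>"
| "val \<iota> (Or a b) \<pi> = max (val \<iota> a \<pi>) (val \<iota> b \<pi>)"
| "val \<iota> (Next a) \<pi> = val \<iota> a (sfx \<pi> 1)"
| "val \<iota> (Until a b) \<pi> =
     (SUP i. min (val \<iota> b (sfx \<pi> i)) (pmin (\<lambda>j. val \<iota> a (sfx \<pi> j)) i))"
| "val \<iota> (DUntil l a b) \<pi> =
     (SUP i. min (\<iota> l i * val \<iota> b (sfx \<pi> i)) (pmin (\<lambda>j. \<iota> l j * val \<iota> a (sfx \<pi> j)) i))"
| "val \<iota> (Avg a b) \<pi> = (val \<iota> a \<pi> + val \<iota> b \<pi>) / 2"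

primrec enc :: "form \<Rightarrow> nat" where
  "enc FTrue = prod_encode (0, 0)"
| "enc (Prop p) = prod_encode (1, p)"
| "enc (Neg a) = prod_encode (2, enc a)"
| "enc (Or a b) = prod_encode (3, prod_encode (enc a, enc b))"
| "enc (Next a) = prod_encode (4, enc a)"
| "enc (Until a b) = prod_encode (5, prod_encode (enc a, enc b))"
| "enc (DUntil l a b) = prod_encode (6, prod_encode (l, prod_encode (enc a, enc b)))"
| "enc (Avg a b) = prod_encode (7, prod_encode (enc a, enc b))"

datatype recf = Zf | Sf | Idf nat | Cnf recf "recf list" | Prf recf recf | Mnf recf

inductive reval :: "recf \<Rightarrow> nat list \<Rightarrow> nat \<Rightarrow> bool" where
  "reval Zf xs 0"
| "reval Sf (x # xs) (Suc x)"
| "i < length xs \<Longrightarrow> reval (Idf i) xs (xs ! i)"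
| "list_all2 (\<lambda>g y. reval g xs y) gs ys \<Longrightarrow> reval f ys z \<Longrightarrow> reval (Cnf f gs) xs z"
| "reval f xs y \<Longrightarrow> reval (Prf f g) (0 # xs) y"
| "reval (Prf f g) (n # xs) y \<Longrightarrow> reval g (n # y # xs) z \<Longrightarrow> reval (Prf f g) (Suc n # xs) z"
| "reval f (n # xs) 0 \<Longrightarrow> (\<forall>m<n. \<exists>k. 0 < k \<and> reval f (m # xs) k) \<Longrightarrow> reval (Mnf f) xs n"

definition valid_above :: "(nat \<Rightarrow> nat \<Rightarrow> real) \<Rightarrow> form \<Rightarrow> real \<Rightarrow> bool" where
  "valid_above \<iota> \<phi> v \<longleftrightarrow> (\<forall>\<pi>. val \<iota> \<phi> \<pi> > v)"

definition decides_validity :: "(nat \<Rightarrow> nat \<Rightarrow> real) \<Rightarrow> recf \<Rightarrow> bool" where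
  "decides_validity \<iota> f \<longleftrightarrow>
     (\<forall>\<phi> p q. p \<le> Suc q \<longrightarrow>
        (let n = prod_encode (enc \<phi>, prod_encode (p, q)) in
          (valid_above \<iota> \<phi> (real p / real (Suc q)) \<longrightarrow> reval f [n] 0) \<and>
          (\<not> valid_above \<iota> \<phi> (real p / real (Suc q)) \<longrightarrow> reval f [n] 1)))"

end

theory Submission
  imports Defs
begin

text \<open>
  For Boolean \<open>b\<close>, the formula \<open>True U\<^sub>\<eta> b\<close> has the value \<open>\<eta> d\<close>, where \<open>d\<close> is the distance to the first
  position satisfying \<open>b\<close>, and \<open>\<not> m U (m \<and> a)\<close> reads the value of \<open>a\<close> at the first position satisfying \<open>m\<close>.
  Since \<open>\<eta>\<close> is injective and \<open>a \<oplus> \<not> b\<close> exceeds \<open>1 / 2\<close> iff \<open>a\<close> exceeds \<open>b\<close>, numbers stored as distances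
  can be compared across consecutive configurations. Hence a disjunction of local defects can state, with
  threshold \<open>1 / 2\<close>, that a word is not a terminating run of a register machine started with \<open>n\<close> in
  register \<open>0\<close>.

  Every \<mu>-recursive function is computed by such a machine, even by a nondeterministic one, which keeps the
  compilation short. If \<open>f\<close> decided validity, consider the function that halts on \<open>n\<close> iff \<open>f\<close> claims
  validity of \<open>\<theta> \<or> I\<^sub>n\<close>, where \<open>n\<close> is the code of \<open>\<theta>\<close> and \<open>I\<^sub>n\<close> says that the input is not \<open>n\<close>. With
  \<open>\<theta>\<close> describing the machine of this very function, its input \<open>n = enc \<theta>\<close> refutes \<open>f\<close>.
\<close>

subsection \<open>Recursive functions as nondeterministic register programs\<close>

inductive_cases reval_ZfE: "reval Zf xs y"
inductive_cases reval_SfE: "reval Sf xs y"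
inductive_cases reval_IdfE: "reval (Idf i) xs y"
inductive_cases reval_CnfE: "reval (Cnf f gs) xs y"
inductive_cases reval_PrfE: "reval (Prf f g) xs y"
inductive_cases reval_MnfE: "reval (Mnf f) xs y"

lemma reval_Zf_iff [simp]: "reval Zf xs y \<longleftrightarrow> y = 0"
  by (auto elim: reval_ZfE intro: reval.intros)

lemma reval_Sf_iff [simp]:
  "reval Sf [] y \<longleftrightarrow> False" "reval Sf (x # xs) y \<longleftrightarrow> y = Suc x"
  by (auto elim: reval_SfE intro: reval.intros)

lemma reval_Idf_iff [simp]: "reval (Idf i) xs y \<longleftrightarrow> i < length xs \<and> y = xs ! i"
  by (auto elim: reval_IdfE intro: reval.intros)

lemma reval_Cnf_iff:
  "reval (Cnf f gs) xs z \<longleftrightarrow> (\<exists>ys. list_all2 (\<lambda>g y. reval g xs y) gs ys \<and> reval f ys z)"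
  by (auto elim: reval_CnfE intro: reval.intros)

lemma reval_Prf_iff [simp]:
  "reval (Prf f g) [] z \<longleftrightarrow> False"
  "reval (Prf f g) (0 # xs) z \<longleftrightarrow> reval f xs z"
  "reval (Prf f g) (Suc n # xs) z \<longleftrightarrow> (\<exists>y. reval (Prf f g) (n # xs) y \<and> reval g (n # y # xs) z)"
  by (auto elim: reval_PrfE intro: reval.intros)

lemma reval_Mnf_iff:
  "reval (Mnf f) xs n \<longleftrightarrow>
     reval f (n # xs) 0 \<and> (\<forall>m<n. \<exists>k. 0 < k \<and> reval f (m # xs) k)"
  by (auto elim: reval_MnfE intro: reval.intros)

lemma reval_functional: "reval f xs y \<Longrightarrow> reval f xs z \<Longrightarrow> y = z"
proof (induction f arbitrary: xs y z)
  case (Cnf f gs)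
  obtain ys where ys: "list_all2 (\<lambda>g y. reval g xs y) gs ys" "reval f ys y"
    using Cnf.prems(1) by (auto simp: reval_Cnf_iff)
  obtain zs where zs: "list_all2 (\<lambda>g y. reval g xs y) gs zs" "reval f zs z"
    using Cnf.prems(2) by (auto simp: reval_Cnf_iff)
  have "ys = zs"
  proof (rule nth_equalityI)
    show "length ys = length zs"
      using ys(1) zs(1) by (simp add: list_all2_conv_all_nth)
    show "ys ! i = zs ! i" if "i < length ys" for i
      using that ys(1) zs(1) Cnf.IH(2)[of "gs ! i"] by (auto simp: list_all2_conv_all_nth)
  qed
  then show ?case using ys zs Cnf.IH(1) by blast
next
  case (Prf f g)
  show ?case
  proof (cases xs)
    case (Cons n ys)
    have "reval (Prf f g) (n # ys) y \<Longrightarrow> reval (Prf f g) (n # ys) z \<Longrightarrow> y = z" for y z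
    proof (induction n arbitrary: y z)
      case 0
      then show ?case using Prf.IH(1) by auto
    next
      case (Suc n)
      then show ?case using Prf.IH(2) by (metis reval_Prf_iff(3))
    qed
    then show ?thesis using Prf.prems Cons by blast
  qed (use Prf.prems in auto)
next
  case (Mnf f)
  \<comment> \<open>The larger of two minimizers would require a positive value of \<open>f\<close>
    where the smaller one has the value \<open>0\<close>.\<close>
  have "\<not> y < z" if "reval (Mnf f) xs y" "reval (Mnf f) xs z" for y z
    using that Mnf.IH unfolding reval_Mnf_iff by fastforce
  then show ?case using Mnf.prems by (meson nat_neq_iff)
next
  case Sf
  then show ?case by (cases xs) auto
qed auto

section \<open>Guarded register programs and their relational semantics\<close>

datatype trm = TZero | Cur nat | CurS nat | Nxt nat | NxtS nat

primrec teval :: "trm \<Rightarrow> (nat \<Rightarrow> nat) \<Rightarrow> (nat \<Rightarrow> nat) \<Rightarrow> nat" where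
  "teval TZero s s' = 0"
| "teval (Cur x) s s' = s x"
| "teval (CurS x) s s' = Suc (s x)"
| "teval (Nxt x) s s' = s' x"
| "teval (NxtS x) s s' = Suc (s' x)"

definition holds :: "(trm \<times> trm) list \<Rightarrow> (nat \<Rightarrow> nat) \<Rightarrow> (nat \<Rightarrow> nat) \<Rightarrow> bool" where
  "holds a s s' \<longleftrightarrow> (\<forall>(t, u)\<in>set a. teval t s s' = teval u s s')"

lemma holds_simps [simp]:
  "holds [] s s'"
  "holds ((t, u) # a) s s' \<longleftrightarrow> teval t s s' = teval u s s' \<and> holds a s s'"
  "holds (a @ b) s s' \<longleftrightarrow> holds a s s' \<and> holds b s s'"
  "holds (map (\<lambda>z. (f z, g z)) zs) s s' \<longleftrightarrow> (\<forall>z\<in>set zs. teval (f z) s s' = teval (g z) s s')"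
  by (auto simp: holds_def)

datatype prog = Atom "(trm \<times> trm) list" | Seq prog prog | Star prog

primrec sem :: "prog \<Rightarrow> ((nat \<Rightarrow> nat) \<times> (nat \<Rightarrow> nat)) set" where
  "sem (Atom a) = {(s, s'). holds a s s'}"
| "sem (Seq c d) = sem c O sem d"
| "sem (Star c) = (sem c)\<^sup>*"

text \<open>Only the registers below \<open>k\<close> are framed; those from \<open>k\<close> on may
  change arbitrarily. The list \<open>g\<close> acts as a guard, since a state for which it cannot
  be satisfied has no successor.\<close>

definition assign :: "nat \<Rightarrow> (trm \<times> trm) list \<Rightarrow> nat \<Rightarrow> trm \<Rightarrow> prog" where
  "assign k g x t = Atom (g @ (Nxt x, t) # map (\<lambda>z. (Nxt z, Cur z)) (filter (\<lambda>z. z \<noteq> x) [0..<k]))"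

lemma sem_assign:
  "(s, s') \<in> sem (assign k g x t) \<longleftrightarrow>
     holds g s s' \<and> s' x = teval t s s' \<and> (\<forall>z<k. z \<noteq> x \<longrightarrow> s' z = s z)"
  by (auto simp: assign_def)

section \<open>Compilation of recursive functions and its correctness\<close>

definition abort :: prog where
  "abort = Atom [(CurS 0, TZero)]"

lemma sem_abort [simp]: "sem abort = {}"
  by (auto simp: abort_def)

primrec eval_all ::
  "(nat list \<Rightarrow> nat \<Rightarrow> nat \<Rightarrow> prog) list \<Rightarrow> nat list \<Rightarrow> nat \<Rightarrow> nat \<Rightarrow> prog" where
  "eval_all [] xs r k = assign k [] 0 (Cur 0)"
| "eval_all (c # cs) xs r k = Seq (c xs r k) (eval_all cs xs (Suc r) k)"

text \<open>\<open>xs\<close> lists the argument registers, \<open>r\<close> is the result register,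
  and the registers from \<open>k\<close> on are scratch space. In both loops \<open>k\<close> holds
  the counter and \<open>k + 1\<close> the current value. For \<open>Prf\<close> the number of
  rounds is guessed, and the final guard compares it with the argument. For \<open>Mnf\<close> every
  round must exhibit a predecessor of the value, as \<open>NxtS\<close> demands; framing only below
  \<open>k + 1\<close> leaves that register free to receive it.\<close>

primrec compile :: "recf \<Rightarrow> nat list \<Rightarrow> nat \<Rightarrow> nat \<Rightarrow> prog" where
  "compile Zf = (\<lambda>xs r k. assign k [] r TZero)"
| "compile Sf = (\<lambda>xs r k. case xs of [] \<Rightarrow> abort | x # _ \<Rightarrow> assign k [] r (CurS x))"
| "compile (Idf i) = (\<lambda>xs r k. if i < length xs then assign k [] r (Cur (xs ! i)) else abort)"
| "compile (Cnf f gs) = (\<lambda>xs r k.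
     Seq (eval_all (map compile gs) xs k (k + length gs))
         (compile f [k..<k + length gs] r (k + length gs)))"
| "compile (Prf f g) = (\<lambda>xs r k. case xs of [] \<Rightarrow> abort | n # ys \<Rightarrow>
     Seq (compile f ys (k + 1) (k + 2))
    (Seq (assign (k + 2) [] k TZero)
    (Seq (Star (Seq (compile g (k # (k + 1) # ys) (k + 1) (k + 2))
                    (assign (k + 2) [] k (CurS k))))
         (assign (k + 2) [(Cur k, Cur n)] r (Cur (k + 1))))))"
| "compile (Mnf f) = (\<lambda>xs r k.
     Seq (assign (k + 2) [] k TZero)
    (Seq (Star (Seq (compile f (k # xs) (k + 1) (k + 2))
                    (assign (k + 1) [(Cur (k + 1), NxtS (k + 1))] k (CurS k))))
    (Seq (compile f (k # xs) (k + 1) (k + 2))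
         (assign (k + 2) [(Cur (k + 1), TZero)] r (Cur k)))))"

text \<open>Partial correctness together with the existence of a successful run for every defined
  value. Wrong guesses contribute no pair to \<open>sem\<close>, so termination of all runs is not
  at issue.\<close>

definition realizes :: "(nat list \<Rightarrow> nat \<Rightarrow> nat \<Rightarrow> prog) \<Rightarrow> recf \<Rightarrow> bool" where
  "realizes c f \<longleftrightarrow> (\<forall>xs r k. set xs \<subseteq> {..<k} \<longrightarrow> r < k \<longrightarrow>
     (\<forall>s s'. (s, s') \<in> sem (c xs r k) \<longrightarrow>
        reval f (map s xs) (s' r) \<and> (\<forall>z<k. z \<noteq> r \<longrightarrow> s' z = s z)) \<and>
     (\<forall>s y. reval f (map s xs) y \<longrightarrow> (\<exists>s'. (s, s') \<in> sem (c xs r k) \<and> s' r = y)))"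

lemma realizes_sound:
  assumes "realizes c f" "set xs \<subseteq> {..<k}" "r < k" "(s, s') \<in> sem (c xs r k)"
  shows "reval f (map s xs) (s' r)" and "z < k \<Longrightarrow> z \<noteq> r \<Longrightarrow> s' z = s z"
  using assms unfolding realizes_def by blast+

lemma realizes_complete:
  assumes "realizes c f" "set xs \<subseteq> {..<k}" "r < k" "reval f (map s xs) y"
  obtains s' where "(s, s') \<in> sem (c xs r k)" "s' r = y" "\<forall>z<k. z \<noteq> r \<longrightarrow> s' z = s z"
  using assms unfolding realizes_def by meson

text \<open>The bounds \<open>set xs \<subseteq> {..<m}\<close> and \<open>m \<le> r\<close> keep
  the argument registers apart from the result registers, so all functions of the list see the same
  arguments.\<close>

lemma eval_all_sound:
  assumes "\<And>g. g \<in> set gs \<Longrightarrow> realizes (compile g) g"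
    and "set xs \<subseteq> {..<m}" "m \<le> r" "r + length gs \<le> k"
    and "(s, s') \<in> sem (eval_all (map compile gs) xs r k)"
  shows "list_all2 (\<lambda>g y. reval g (map s xs) y) gs (map s' [r..<r + length gs])
    \<and> (\<forall>z<k. z \<notin> {r..<r + length gs} \<longrightarrow> s' z = s z)"
  using assms
proof (induction gs arbitrary: r s)
  case Nil
  then show ?case by (auto simp: sem_assign)
next
  case (Cons g gs)
  from Cons.prems(5) obtain s1 where s1: "(s, s1) \<in> sem (compile g xs r k)"
    "(s1, s') \<in> sem (eval_all (map compile gs) xs (Suc r) k)" by auto
  have xs: "set xs \<subseteq> {..<k}" "r < k" using Cons.prems by auto
  have g: "realizes (compile g) g" using Cons.prems by simp
  note 1 = realizes_sound[OF g xs s1(1)]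
  have IH: "list_all2 (\<lambda>g y. reval g (map s1 xs) y) gs (map s' [Suc r..<Suc r + length gs])
    \<and> (\<forall>z<k. z \<notin> {Suc r..<Suc r + length gs} \<longrightarrow> s' z = s1 z)"
    by (rule Cons.IH) (use Cons.prems s1 in auto)
  have eq: "map s1 xs = map s xs"
    using 1(2) xs Cons.prems(2,3) by (intro map_cong) auto
  have "s' r = s1 r" using IH xs by auto
  moreover have upt: "[r..<r + length (g # gs)] = r # [Suc r..<Suc r + length gs]"
    by (simp add: upt_rec)
  ultimately show ?case using IH[unfolded eq] 1 unfolding upt by (auto simp del: upt_Suc)
qed

lemma eval_all_complete:
  assumes "\<And>g. g \<in> set gs \<Longrightarrow> realizes (compile g) g"
    and "set xs \<subseteq> {..<m}" "m \<le> r" "r + length gs \<le> k"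
    and "list_all2 (\<lambda>g y. reval g (map s xs) y) gs ys"
  shows "\<exists>s'. (s, s') \<in> sem (eval_all (map compile gs) xs r k)
    \<and> map s' [r..<r + length gs] = ys"
  using assms
proof (induction gs arbitrary: r s ys)
  case Nil
  then show ?case by (auto simp: sem_assign intro: exI[of _ s])
next
  case (Cons g gs)
  from Cons.prems(5) obtain y zs where ys: "ys = y # zs" "reval g (map s xs) y"
    "list_all2 (\<lambda>g y. reval g (map s xs) y) gs zs"
    by (auto simp: list_all2_Cons1)
  have xs: "set xs \<subseteq> {..<k}" "r < k" using Cons.prems by auto
  have g: "realizes (compile g) g" using Cons.prems by simp
  obtain s1 where s1: "(s, s1) \<in> sem (compile g xs r k)" "s1 r = y"
    "\<forall>z<k. z \<noteq> r \<longrightarrow> s1 z = s z"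
    by (rule realizes_complete[OF g xs ys(2)])
  have eq: "map s1 xs = map s xs"
    using s1(3) xs Cons.prems(2,3) by (intro map_cong) auto
  obtain s' where s': "(s1, s') \<in> sem (eval_all (map compile gs) xs (Suc r) k)"
    "map s' [Suc r..<Suc r + length gs] = zs"
    using Cons.IH[of "Suc r" s1 zs] Cons.prems ys(3) eq by auto
  have "s' r = s1 r"
    using eval_all_sound[OF _ _ _ _ s'(1), of m] Cons.prems xs by auto
  moreover have "[r..<r + length (g # gs)] = r # [Suc r..<Suc r + length gs]"
    by (simp add: upt_rec)
  ultimately show ?case using s1 s' ys(1) by auto
qed

lemma realizes_Cnf:
  assumes f: "realizes (compile f) f" and gs: "\<And>g. g \<in> set gs \<Longrightarrow> realizes (compile g) g"
  shows "realizes (compile (Cnf f gs)) (Cnf f gs)"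
  unfolding realizes_def
proof (intro allI impI conjI)
  fix xs :: "nat list" and r k assume xs: "set xs \<subseteq> {..<k}" and r: "r < k"
  define m where "m = k + length gs"
  have ks: "set [k..<m] \<subseteq> {..<m}" "r < m" using r by (auto simp: m_def)
  {
    fix s s' assume "(s, s') \<in> sem (compile (Cnf f gs) xs r k)"
    then obtain s1 where s1: "(s, s1) \<in> sem (eval_all (map compile gs) xs k m)"
      "(s1, s') \<in> sem (compile f [k..<m] r m)" by (auto simp: m_def)
    note 1 = eval_all_sound[OF gs xs order.refl _ s1(1)]
    note 2 = realizes_sound[OF f ks s1(2)]
    show "reval (Cnf f gs) (map s xs) (s' r)"
      using 1 2(1) by (auto simp: reval_Cnf_iff m_def)
    show "s' z = s z" if "z < k" "z \<noteq> r" for z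
      using that 1 2(2)[of z] by (auto simp: m_def)
  }
  fix s y assume "reval (Cnf f gs) (map s xs) y"
  then obtain ys where ys: "list_all2 (\<lambda>g y. reval g (map s xs) y) gs ys" "reval f ys y"
    by (auto simp: reval_Cnf_iff)
  obtain s1 where s1: "(s, s1) \<in> sem (eval_all (map compile gs) xs k m)" "map s1 [k..<m] = ys"
    using eval_all_complete[OF gs xs order.refl _ ys(1)] m_def by blast
  obtain s' where "(s1, s') \<in> sem (compile f [k..<m] r m)" "s' r = y"
    using realizes_complete[OF f ks] ys(2) s1(2) by metis
  then show "\<exists>s'. (s, s') \<in> sem (compile (Cnf f gs) xs r k) \<and> s' r = y"
    using s1(1) by (auto simp: m_def)
qed

lemma realizes_Prf:
  assumes f: "realizes (compile f) f" and g: "realizes (compile g) g"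
  shows "realizes (compile (Prf f g)) (Prf f g)"
  unfolding realizes_def
proof (intro allI impI conjI)
  fix ns :: "nat list" and r k assume ns: "set ns \<subseteq> {..<k}" and r: "r < k"
  define body where "body ys = Seq (compile g (k # (k + 1) # ys) (k + 1) (k + 2))
    (assign (k + 2) [] k (CurS k))" for ys
  {
    fix s s' assume "(s, s') \<in> sem (compile (Prf f g) ns r k)"
    then obtain n ys where [simp]: "ns = n # ys" by (cases ns) auto
    have ys: "set ys \<subseteq> {..<k + 2}" "set (k # (k + 1) # ys) \<subseteq> {..<k + 2}" "k + 1 < k + 2"
      using ns by auto
    from \<open>(s, s') \<in> _\<close> obtain s1 s2 s3 where
      s1: "(s, s1) \<in> sem (compile f ys (k + 1) (k + 2))" and
      s2: "(s1, s2) \<in> sem (assign (k + 2) [] k TZero)" and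
      s3: "(s2, s3) \<in> (sem (body ys))\<^sup>*" and
      s4: "(s3, s') \<in> sem (assign (k + 2) [(Cur k, Cur n)] r (Cur (k + 1)))"
      by (auto simp: body_def)
    have f1: "reval f (map s ys) (s1 (k + 1))" "\<forall>z<k. s1 z = s z"
      using realizes_sound[OF f ys(1,3) s1] by auto
    have f2: "s2 k = 0" "s2 (k + 1) = s1 (k + 1)" "\<forall>z<k. s2 z = s z"
      using s2 f1 by (auto simp: sem_assign)
    \<comment> \<open>Loop invariant: the accumulator \<open>k + 1\<close> holds the recursion value
      at the counter \<open>k\<close>, however many rounds are guessed.\<close>
    from s3 have f3: "reval (Prf f g) (s3 k # map s ys) (s3 (k + 1)) \<and> (\<forall>z<k. s3 z = s z)"
    proof (induction rule: rtrancl_induct)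
      case base
      then show ?case using f1 f2 by simp
    next
      case (step u v)
      from step.hyps(2) obtain w where w: "(u, w) \<in> sem (compile g (k # (k + 1) # ys) (k + 1) (k + 2))"
        "(w, v) \<in> sem (assign (k + 2) [] k (CurS k))" by (auto simp: body_def)
      have "map u ys = map s ys" using step.IH ns by (intro map_cong) auto
      then have "reval g (u k # u (k + 1) # map s ys) (w (k + 1))"
        using realizes_sound(1)[OF g ys(2,3) w(1)] by (simp del: map_eq_conv)
      moreover have "\<forall>z<k + 2. z \<noteq> k + 1 \<longrightarrow> w z = u z"
        using realizes_sound(2)[OF g ys(2,3) w(1)] by blast
      ultimately show ?case using w(2) step.IH by (auto simp: sem_assign)
    qed
    \<comment> \<open>The guard equates the counter with register \<open>n\<close>, which lies below
      \<open>k\<close> and so still holds the original argument.\<close>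
    have f4: "s3 k = s3 n" "s' r = s3 (k + 1)" "\<forall>z<k. z \<noteq> r \<longrightarrow> s' z = s3 z"
      using s4 r by (auto simp: sem_assign)
    show "reval (Prf f g) (map s ns) (s' r)"
      using f3 f4 ns by (metis \<open>ns = n # ys\<close> insert_subset lessThan_iff list.set(2) list.simps(9))
    show "s' z = s z" if "z < k" "z \<noteq> r" for z using f3 f4 that by simp
  }
  fix s y assume y: "reval (Prf f g) (map s ns) y"
  then obtain n ys where [simp]: "ns = n # ys" by (cases ns) auto
  have ys: "set ys \<subseteq> {..<k + 2}" "set (k # (k + 1) # ys) \<subseteq> {..<k + 2}" "k + 1 < k + 2"
    using ns by auto
  have loop: "reval (Prf f g) (m # map s ys) v \<Longrightarrow>
    \<exists>s1 s2 s3. (s, s1) \<in> sem (compile f ys (k + 1) (k + 2)) \<and>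
      (s1, s2) \<in> sem (assign (k + 2) [] k TZero) \<and> (s2, s3) \<in> (sem (body ys))\<^sup>* \<and>
      s3 k = m \<and> s3 (k + 1) = v \<and> (\<forall>z<k. s3 z = s z)" for m v
  proof (induction m arbitrary: v)
    case 0
    then have "reval f (map s ys) v" by simp
    then obtain s1 where s1: "(s, s1) \<in> sem (compile f ys (k + 1) (k + 2))" "s1 (k + 1) = v"
      "\<forall>z<k + 2. z \<noteq> k + 1 \<longrightarrow> s1 z = s z"
      using realizes_complete[OF f ys(1,3)] by metis
    have "(s1, s1(k := 0)) \<in> sem (assign (k + 2) [] k TZero)"
      by (auto simp: sem_assign)
    moreover have "(s1(k := 0)) k = 0" "(s1(k := 0)) (k + 1) = v" "\<forall>z<k. (s1(k := 0)) z = s z"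
      using s1 by auto
    ultimately show ?case using s1(1) rtrancl.rtrancl_refl by blast
  next
    case (Suc m)
    then obtain u where u: "reval (Prf f g) (m # map s ys) u" "reval g (m # u # map s ys) v"
      by auto
    then obtain s1 s2 s3 where
      s1: "(s, s1) \<in> sem (compile f ys (k + 1) (k + 2))" and
      s2: "(s1, s2) \<in> sem (assign (k + 2) [] k TZero)" and s3: "(s2, s3) \<in> (sem (body ys))\<^sup>*"
      and e: "s3 k = m" "s3 (k + 1) = u" "\<forall>z<k. s3 z = s z"
      using Suc.IH by blast
    have "map s3 ys = map s ys" using e(3) ns by (intro map_cong) auto
    then have "reval g (map s3 (k # (k + 1) # ys)) v"
      using u(2) e by (simp del: map_eq_conv)
    then obtain w where w: "(s3, w) \<in> sem (compile g (k # (k + 1) # ys) (k + 1) (k + 2))"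
      "w (k + 1) = v" "\<forall>z<k + 2. z \<noteq> k + 1 \<longrightarrow> w z = s3 z"
      using realizes_complete[OF g ys(2,3)] by metis
    have "(w, w(k := Suc m)) \<in> sem (assign (k + 2) [] k (CurS k))"
      using w e by (auto simp: sem_assign)
    then have "(s3, w(k := Suc m)) \<in> sem (body ys)" using w(1) by (auto simp: body_def)
    then have "(s2, w(k := Suc m)) \<in> (sem (body ys))\<^sup>*" using s3 by (rule rtrancl_into_rtrancl[rotated])
    moreover have "(w(k := Suc m)) k = Suc m" "(w(k := Suc m)) (k + 1) = v"
      "\<forall>z<k. (w(k := Suc m)) z = s z"
      using w e by auto
    ultimately show ?case using s1 s2 by blast
  qed
  obtain s1 s2 s3 where
    s1: "(s, s1) \<in> sem (compile f ys (k + 1) (k + 2))" and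
    s2: "(s1, s2) \<in> sem (assign (k + 2) [] k TZero)" and s3: "(s2, s3) \<in> (sem (body ys))\<^sup>*"
    and e: "s3 k = s n" "s3 (k + 1) = y" "\<forall>z<k. s3 z = s z"
    using loop[of "s n" y] y by auto
  have "(s3, s3(r := y)) \<in> sem (assign (k + 2) [(Cur k, Cur n)] r (Cur (k + 1)))"
    using e r ns by (auto simp: sem_assign)
  then show "\<exists>s'. (s, s') \<in> sem (compile (Prf f g) ns r k) \<and> s' r = y"
    using s1 s2 s3 by (intro exI[of _ "s3(r := y)"]) (auto simp: body_def intro!: relcompI)
qed

lemma realizes_Mnf:
  assumes f: "realizes (compile f) f"
  shows "realizes (compile (Mnf f)) (Mnf f)"
  unfolding realizes_def
proof (intro allI impI conjI)
  fix xs :: "nat list" and r k assume xs: "set xs \<subseteq> {..<k}" and r: "r < k"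
  define body where "body = Seq (compile f (k # xs) (k + 1) (k + 2))
    (assign (k + 1) [(Cur (k + 1), NxtS (k + 1))] k (CurS k))"
  have ks: "set (k # xs) \<subseteq> {..<k + 2}" "k + 1 < k + 2" using xs by auto
  {
    fix s s' assume "(s, s') \<in> sem (compile (Mnf f) xs r k)"
    then obtain s1 s2 s3 where
      s1: "(s, s1) \<in> sem (assign (k + 2) [] k TZero)" and
      s2: "(s1, s2) \<in> (sem body)\<^sup>*" and
      s3: "(s2, s3) \<in> sem (compile f (k # xs) (k + 1) (k + 2))" and
      s4: "(s3, s') \<in> sem (assign (k + 2) [(Cur (k + 1), TZero)] r (Cur k))"
      by (auto simp: body_def)
    have f1: "s1 k = 0" "\<forall>z<k. s1 z = s z" using s1 by (auto simp: sem_assign)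
    from s2 have f2: "(\<forall>m<s2 k. \<exists>v>0. reval f (m # map s xs) v) \<and> (\<forall>z<k. s2 z = s z)"
    proof (induction rule: rtrancl_induct)
      case base
      then show ?case using f1 by simp
    next
      case (step u v)
      from step.hyps(2) obtain w where w: "(u, w) \<in> sem (compile f (k # xs) (k + 1) (k + 2))"
        "(w, v) \<in> sem (assign (k + 1) [(Cur (k + 1), NxtS (k + 1))] k (CurS k))"
        by (auto simp: body_def)
      have "map u xs = map s xs" using step.IH xs by (intro map_cong) auto
      then have "reval f (u k # map s xs) (w (k + 1))"
        using realizes_sound(1)[OF f ks w(1)] by (simp del: map_eq_conv)
      moreover have "\<forall>z<k + 2. z \<noteq> k + 1 \<longrightarrow> w z = u z"
        using realizes_sound(2)[OF f ks w(1)] by blast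
      moreover have "v k = Suc (w k)" "w (k + 1) > 0" "\<forall>z<k. v z = w z"
        using w(2) by (auto simp: sem_assign)
      ultimately show ?case using step.IH by (auto simp: less_Suc_eq)
    qed
    have "map s2 xs = map s xs" using f2 xs by (intro map_cong) auto
    then have f3: "reval f (s2 k # map s xs) (s3 (k + 1))" "\<forall>z<k. s3 z = s z" "s3 k = s2 k"
      using realizes_sound[OF f ks s3] f2 by (auto simp del: map_eq_conv)
    have f4: "s3 (k + 1) = 0" "s' r = s3 k" "\<forall>z<k. z \<noteq> r \<longrightarrow> s' z = s3 z"
      using s4 r by (auto simp: sem_assign)
    show "reval (Mnf f) (map s xs) (s' r)" using f2 f3 f4 by (simp add: reval_Mnf_iff)
    show "s' z = s z" if "z < k" "z \<noteq> r" for z using f3 f4 that by simp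
  }
  fix s y assume y: "reval (Mnf f) (map s xs) y"
  have loop: "m \<le> y \<Longrightarrow> \<exists>s1 s2. (s, s1) \<in> sem (assign (k + 2) [] k TZero) \<and>
    (s1, s2) \<in> (sem body)\<^sup>* \<and> s2 k = m \<and> (\<forall>z<k. s2 z = s z)" for m
  proof (induction m)
    case 0
    have "(s, s(k := 0)) \<in> sem (assign (k + 2) [] k TZero)"
      by (auto simp: sem_assign)
    moreover have "(s(k := 0)) k = 0" "\<forall>z<k. (s(k := 0)) z = s z" by auto
    ultimately show ?case using rtrancl.rtrancl_refl by blast
  next
    case (Suc m)
    from Suc.prems obtain v where v: "v > 0" "reval f (m # map s xs) v"
      using y by (auto simp: reval_Mnf_iff Suc_le_eq)
    obtain s1 s2 where s1: "(s, s1) \<in> sem (assign (k + 2) [] k TZero)" and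
      s2: "(s1, s2) \<in> (sem body)\<^sup>*" and e: "s2 k = m" "\<forall>z<k. s2 z = s z"
      using Suc by auto
    have "map s2 xs = map s xs" using e(2) xs by (intro map_cong) auto
    then have "reval f (map s2 (k # xs)) v" using v(2) e by (simp del: map_eq_conv)
    then obtain w where w: "(s2, w) \<in> sem (compile f (k # xs) (k + 1) (k + 2))"
      "w (k + 1) = v" "\<forall>z<k + 2. z \<noteq> k + 1 \<longrightarrow> w z = s2 z"
      using realizes_complete[OF f ks] by metis
    \<comment> \<open>Storing \<open>v - 1\<close> supplies the predecessor that the guard asks for;
      \<open>v\<close> is positive because \<open>m\<close> lies below the minimizer
      \<open>y\<close>.\<close>
    have "(w, w(k := Suc m, k + 1 := v - 1))
        \<in> sem (assign (k + 1) [(Cur (k + 1), NxtS (k + 1))] k (CurS k))"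
      using w e v(1) by (auto simp: sem_assign)
    then have "(s2, w(k := Suc m, k + 1 := v - 1)) \<in> sem body"
      using w(1) by (auto simp: body_def)
    then have "(s1, w(k := Suc m, k + 1 := v - 1)) \<in> (sem body)\<^sup>*"
      using s2 by (rule rtrancl_into_rtrancl[rotated])
    moreover have "(w(k := Suc m, k + 1 := v - 1)) k = Suc m"
      "\<forall>z<k. (w(k := Suc m, k + 1 := v - 1)) z = s z"
      using w e by auto
    ultimately show ?case using s1 by blast
  qed
  obtain s1 s2 where s1: "(s, s1) \<in> sem (assign (k + 2) [] k TZero)" and
    s2: "(s1, s2) \<in> (sem body)\<^sup>*" and e: "s2 k = y" "\<forall>z<k. s2 z = s z"
    using loop[of y] by auto
  have "map s2 xs = map s xs" using e(2) xs by (intro map_cong) auto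
  then have "reval f (map s2 (k # xs)) 0"
    using y e by (simp add: reval_Mnf_iff del: map_eq_conv)
  then obtain s3 where s3: "(s2, s3) \<in> sem (compile f (k # xs) (k + 1) (k + 2))"
    "s3 (k + 1) = 0" "\<forall>z<k + 2. z \<noteq> k + 1 \<longrightarrow> s3 z = s2 z"
    using realizes_complete[OF f ks] by metis
  have "(s3, s3(r := y)) \<in> sem (assign (k + 2) [(Cur (k + 1), TZero)] r (Cur k))"
    using s3 e r by (auto simp: sem_assign)
  then show "\<exists>s'. (s, s') \<in> sem (compile (Mnf f) xs r k) \<and> s' r = y"
    using s1 s2 s3(1) by (intro exI[of _ "s3(r := y)"]) (auto simp: body_def intro!: relcompI)
qed

text \<open>Each base function needs a single assignment. The quantification over \<open>s'\<close>
  makes the value of \<open>t\<close> independent of the next state, so \<open>s(r := y)\<close> can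
  serve as that state.\<close>

lemma realizes_assign:
  assumes "\<And>xs r k. set xs \<subseteq> {..<k} \<Longrightarrow> c xs r k = abort \<and> (\<forall>s y. \<not> reval f (map s xs) y) \<or>
    (\<exists>t. c xs r k = assign k [] r t \<and> (\<forall>s s' y. reval f (map s xs) y \<longleftrightarrow> y = teval t s s'))"
  shows "realizes c f"
  unfolding realizes_def
proof (intro allI impI)
  fix xs :: "nat list" and r k :: nat
  assume "set xs \<subseteq> {..<k}" "r < k"
  from assms[OF this(1), of r] show "(\<forall>s s'. (s, s') \<in> sem (c xs r k) \<longrightarrow>
        reval f (map s xs) (s' r) \<and> (\<forall>z<k. z \<noteq> r \<longrightarrow> s' z = s z)) \<and>
     (\<forall>s y. reval f (map s xs) y \<longrightarrow> (\<exists>s'. (s, s') \<in> sem (c xs r k) \<and> s' r = y))"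
  proof (elim disjE exE conjE)
    fix t assume c: "c xs r k = assign k [] r t"
      and f: "\<forall>s s' y. reval f (map s xs) y \<longleftrightarrow> y = teval t s s'"
    have "\<exists>s'. (s, s') \<in> sem (c xs r k) \<and> s' r = y" if "reval f (map s xs) y" for s y
      using that f by (intro exI[of _ "s(r := y)"]) (auto simp: c sem_assign)
    then show ?thesis using f by (auto simp: c sem_assign)
  qed auto
qed

lemma realizes_compile: "realizes (compile f) f"
proof (induction f)
  case Zf
  show ?case by (rule realizes_assign) (auto intro!: exI[of _ TZero])
next
  case Sf
  show ?case
  proof (rule realizes_assign)
    fix xs :: "nat list" and r k
    show "compile Sf xs r k = abort \<and> (\<forall>s y. \<not> reval Sf (map s xs) y) \<or>
      (\<exists>t. compile Sf xs r k = assign k [] r t \<and>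
        (\<forall>s s' y. reval Sf (map s xs) y \<longleftrightarrow> y = teval t s s'))"
      by (cases xs) (auto intro!: exI[of _ "CurS (hd xs)"])
  qed
next
  case (Idf i)
  show ?case
  proof (rule realizes_assign)
    fix xs :: "nat list" and r k
    show "compile (Idf i) xs r k = abort \<and> (\<forall>s y. \<not> reval (Idf i) (map s xs) y) \<or>
      (\<exists>t. compile (Idf i) xs r k = assign k [] r t \<and>
        (\<forall>s s' y. reval (Idf i) (map s xs) y \<longleftrightarrow> y = teval t s s'))"
      by (cases "i < length xs") (auto intro!: exI[of _ "Cur (xs ! i)"])
  qed
qed (simp_all only: realizes_Cnf realizes_Prf realizes_Mnf)

corollary compile_terminates_iff:
  assumes "s 0 = n"
  shows "(\<exists>s'. (s, s') \<in> sem (compile f [0] 1 2)) \<longleftrightarrow> (\<exists>y. reval f [n] y)"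
proof -
  have *: "set [0] \<subseteq> {..<2::nat}" "1 < (2::nat)" "map s [0] = [n]" using assms by auto
  note sound = realizes_sound(1)[OF realizes_compile *(1,2)]
  note complete = realizes_complete[OF realizes_compile *(1,2)]
  show ?thesis using sound complete *(3) by metis
qed

subsection \<open>From programs to transition graphs\<close>

type_synonym 'q edge = "'q \<times> (trm \<times> trm) list option \<times> 'q"

text \<open>Locations are the lists of programs still to be executed. Equal lists arising at
  different places are identified, which is harmless because \<open>sem_list\<close> depends on the
  list alone. The label \<open>None\<close> keeps the entire state, which no finite list of
  equations can express.\<close>

fun edges :: "prog \<Rightarrow> prog list \<Rightarrow> prog list edge list" where
  "edges (Atom a) k = [(Atom a # k, Some a, k)]"
| "edges (Seq c d) k = (Seq c d # k, None, c # d # k) # edges c (d # k) @ edges d k"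
| "edges (Star c) k =
     (Star c # k, None, k) # (Star c # k, None, c # Star c # k) # edges c (Star c # k)"

fun action :: "(trm \<times> trm) list option \<Rightarrow> (nat \<Rightarrow> nat) \<Rightarrow> (nat \<Rightarrow> nat) \<Rightarrow> bool" where
  "action None s s' \<longleftrightarrow> s' = s"
| "action (Some a) s s' \<longleftrightarrow> holds a s s'"

definition step :: "'q edge list \<Rightarrow> (('q \<times> (nat \<Rightarrow> nat)) \<times> ('q \<times> (nat \<Rightarrow> nat))) set" where
  "step es = {((p, s), (q, s')). \<exists>a. (p, a, q) \<in> set es \<and> action a s s'}"

primrec sem_list :: "prog list \<Rightarrow> ((nat \<Rightarrow> nat) \<times> (nat \<Rightarrow> nat)) set" where
  "sem_list [] = Id"
| "sem_list (c # k) = sem c O sem_list k"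

lemma sem_list_Seq: "sem_list (Seq c d # k) = sem_list (c # d # k)"
  by (simp add: O_assoc)

lemma sem_list_Star: "sem_list (Star c # k) = sem_list k \<union> sem_list (c # Star c # k)"
proof -
  have "(sem c)\<^sup>* = Id \<union> sem c O (sem c)\<^sup>*"
    using rtrancl_unfold[of "sem c"] by (simp add: r_comp_rtrancl_eq)
  then have "(sem c)\<^sup>* O sem_list k = (Id \<union> sem c O (sem c)\<^sup>*) O sem_list k" by simp
  then show ?thesis by (simp add: relcomp_distrib2 O_assoc)
qed

lemma edge_sem_list:
  "(p, a, q) \<in> set (edges c k) \<Longrightarrow> action a s s1 \<Longrightarrow> (s1, s') \<in> sem_list q \<Longrightarrow> (s, s') \<in> sem_list p"
proof (induction c k rule: edges.induct)
  case (1 a k)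
  then show ?case by auto
next
  case (2 c d k)
  have "(s, s') \<in> sem_list p" if "p = Seq c d # k" "a = None" "q = c # d # k"
    using that 2(4,5) unfolding that(1) sem_list_Seq by simp
  then show ?case using 2 by auto
next
  case (3 c k)
  have "(s, s') \<in> sem_list p" if "p = Star c # k" "a = None" "q = k \<or> q = c # Star c # k"
    using that 3(3,4) unfolding that(1) sem_list_Star by auto
  moreover have "p = Star c # k \<and> a = None \<and> (q = k \<or> q = c # Star c # k)
      \<or> (p, a, q) \<in> set (edges c (Star c # k))"
    using 3(2) by auto
  ultimately show ?case using 3(1,3,4) by blast
qed

lemma step_sem_list:
  "((p, s), ([], s')) \<in> (step (edges c k))\<^sup>* \<Longrightarrow> (s, s') \<in> sem_list p"
proof (induction "(p, s)" arbitrary: p s rule: converse_rtrancl_induct)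
  case (step z)
  then show ?case by (cases z) (auto simp: step_def intro: edge_sem_list)
qed simp

lemma step_mono: "set es \<subseteq> set es' \<Longrightarrow> (step es)\<^sup>* \<subseteq> (step es')\<^sup>*"
  by (rule rtrancl_mono) (auto simp: step_def)

lemma sem_step: "(s, s') \<in> sem c \<Longrightarrow> ((c # k, s), (k, s')) \<in> (step (edges c k))\<^sup>*"
proof (induction c arbitrary: s s' k)
  case (Atom a)
  then show ?case by (intro r_into_rtrancl) (auto simp: step_def)
next
  case (Seq c d)
  let ?E = "(step (edges (Seq c d) k))\<^sup>*"
  from Seq.prems obtain s1 where s1: "(s, s1) \<in> sem c" "(s1, s') \<in> sem d" by auto
  have "((Seq c d # k, s), (c # d # k, s)) \<in> ?E"
    by (rule r_into_rtrancl) (auto simp: step_def)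
  also have "((c # d # k, s), (d # k, s1)) \<in> ?E"
    by (rule subsetD[OF step_mono Seq.IH(1)[OF s1(1)]]) auto
  also have "((d # k, s1), (k, s')) \<in> ?E"
    by (rule subsetD[OF step_mono Seq.IH(2)[OF s1(2)]]) auto
  finally show ?case .
next
  case (Star c)
  let ?E = "(step (edges (Star c) k))\<^sup>*"
  have loop: "((Star c # k, s), (Star c # k, t)) \<in> ?E" if "(s, t) \<in> (sem c)\<^sup>*" for t
    using that
  proof (induction rule: rtrancl_induct)
    case (step t u)
    note step.IH
    also have "((Star c # k, t), (c # Star c # k, t)) \<in> ?E"
      by (rule r_into_rtrancl) (auto simp: step_def)
    also have "((c # Star c # k, t), (Star c # k, u)) \<in> ?E"
      by (rule subsetD[OF step_mono Star.IH[OF step.hyps(2)]]) auto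
    finally show ?case .
  qed simp
  have "((Star c # k, s), (Star c # k, s')) \<in> ?E" using loop Star.prems by simp
  also have "((Star c # k, s'), (k, s')) \<in> ?E"
    by (rule r_into_rtrancl) (auto simp: step_def)
  finally show ?case .
qed

lemma step_edges_iff:
  "((([c], s), ([], s')) \<in> (step (edges c []))\<^sup>*) \<longleftrightarrow> (s, s') \<in> sem c"
  using step_sem_list[of "[c]" s s' c "[]"] sem_step[of s s' c "[]"] by auto

subsection \<open>Values of formulas\<close>

lemma sfx_apply [simp]: "sfx \<pi> i k = \<pi> (i + k)"
  by (simp add: sfx_def)

lemma sfx_sfx [simp]: "sfx (sfx \<pi> i) j = sfx \<pi> (i + j)"
  by (auto simp: sfx_def add.assoc)

lemma sfx_0 [simp]: "sfx \<pi> 0 = \<pi>"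
  by (auto simp: sfx_def)

lemma pmin_le_1: "pmin f i \<le> 1"
  unfolding pmin_def by (rule Min_le) auto

lemma pmin_le: "j < i \<Longrightarrow> pmin f i \<le> f j"
  unfolding pmin_def by (rule Min_le) auto

lemma le_pmin_iff: "c \<le> pmin f i \<longleftrightarrow> c \<le> 1 \<and> (\<forall>j<i. c \<le> f j)"
  unfolding pmin_def by (subst Min_ge_iff) auto

lemma SUP_real_eqI:
  fixes f :: "nat \<Rightarrow> real"
  assumes "\<And>i. f i \<le> c" "f k = c"
  shows "(SUP i. f i) = c"
  by (rule cSup_eq_maximum) (use assms in auto)

definition And :: "form \<Rightarrow> form \<Rightarrow> form" where
  "And a b = Neg (Or (Neg a) (Neg b))"

definition Ev :: "form \<Rightarrow> form" where
  "Ev a = Until FTrue a"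

definition Gt :: "form \<Rightarrow> form \<Rightarrow> form" where
  "Gt a b = Avg a (Neg b)"

primrec Disj :: "form list \<Rightarrow> form" where
  "Disj [] = Neg FTrue"
| "Disj (a # as) = Or a (Disj as)"

locale discounted =
  fixes \<iota> :: "nat \<Rightarrow> nat \<Rightarrow> real"
  assumes disc: "discounting (\<iota> l)"
begin

abbreviation v :: "form \<Rightarrow> (nat \<Rightarrow> nat set) \<Rightarrow> real" where
  "v \<equiv> val \<iota>"

definition sat :: "form \<Rightarrow> (nat \<Rightarrow> nat set) \<Rightarrow> bool" where
  "sat a \<pi> \<longleftrightarrow> v a \<pi> > 1 / 2"

definition bool_val :: "form \<Rightarrow> ((nat \<Rightarrow> nat set) \<Rightarrow> bool) \<Rightarrow> bool" where
  "bool_val a P \<longleftrightarrow> (\<forall>\<pi>. v a \<pi> = of_bool (P \<pi>))"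

lemma disc_range: "0 \<le> \<iota> l i" "\<iota> l i \<le> 1"
  using disc by (auto simp: discounting_def)

lemma disc_less: "i < j \<Longrightarrow> \<iota> l j < \<iota> l i"
  using disc by (auto simp: discounting_def)

lemma disc_le: "i \<le> j \<Longrightarrow> \<iota> l j \<le> \<iota> l i"
  using disc_less[of i j l] by (cases "i = j") auto

lemma disc_inj [simp]: "\<iota> l i = \<iota> l j \<longleftrightarrow> i = j"
  using disc_less[of i j l] disc_less[of j i l] by (cases i j rule: linorder_cases) auto

text \<open>The terms of both untils are bounded along the way, since a real supremum is informative
  only for nonempty bounded sets.\<close>

lemma val_range: "0 \<le> v a \<pi>" "v a \<pi> \<le> 1"
proof -
  have "0 \<le> v a \<pi> \<and> v a \<pi> \<le> 1"
  proof (induction a arbitrary: \<pi>)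
    case (Until a b)
    let ?f = "\<lambda>i. min (v b (sfx \<pi> i)) (pmin (\<lambda>j. v a (sfx \<pi> j)) i)"
    have 1: "?f i \<le> 1" "0 \<le> ?f i" for i
      using Until.IH by (auto simp: le_pmin_iff intro: min.coboundedI1)
    have "?f 0 \<le> (SUP i. ?f i)" by (intro cSUP_upper bdd_aboveI2[of _ _ 1]) (auto simp: 1(1))
    moreover have "(SUP i. ?f i) \<le> 1" by (rule cSUP_least) (use 1 in auto)
    moreover have "0 \<le> ?f 0" by (rule 1)
    ultimately show ?case by (metis (no_types, lifting) val.simps(6) order_trans)
  next
    case (DUntil l a b)
    let ?f = "\<lambda>i. min (\<iota> l i * v b (sfx \<pi> i)) (pmin (\<lambda>j. \<iota> l j * v a (sfx \<pi> j)) i)"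
    have 1: "?f i \<le> 1" "0 \<le> ?f i" for i
      using DUntil.IH disc_range
      by (auto simp: le_pmin_iff intro!: min.coboundedI1 mult_le_one)
    have "?f 0 \<le> (SUP i. ?f i)" by (intro cSUP_upper bdd_aboveI2[of _ _ 1]) (auto simp: 1(1))
    moreover have "(SUP i. ?f i) \<le> 1" by (rule cSUP_least) (use 1 in auto)
    moreover have "0 \<le> ?f 0" by (rule 1)
    ultimately show ?case by (metis (no_types, lifting) val.simps(7) order_trans)
  next
    case (Avg a b)
    from Avg.IH(1)[of \<pi>] Avg.IH(2)[of \<pi>] show ?case by simp
  qed (auto simp: le_max_iff_disj)
  then show "0 \<le> v a \<pi>" "v a \<pi> \<le> 1" by auto
qed

lemma val_And: "v (And a b) \<pi> = min (v a \<pi>) (v b \<pi>)"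
  by (auto simp: And_def)

lemma sat_Or: "sat (Or a b) \<pi> \<longleftrightarrow> sat a \<pi> \<or> sat b \<pi>"
  by (auto simp: sat_def)

lemma sat_And: "sat (And a b) \<pi> \<longleftrightarrow> sat a \<pi> \<and> sat b \<pi>"
  by (auto simp: sat_def val_And)

lemma sat_Gt: "sat (Gt a b) \<pi> \<longleftrightarrow> v b \<pi> < v a \<pi>"
  by (auto simp: sat_def Gt_def)

lemma sat_Disj: "sat (Disj as) \<pi> \<longleftrightarrow> (\<exists>a\<in>set as. sat a \<pi>)"
  by (induction as) (auto simp: sat_def)

lemma pmin_one [simp]: "pmin (\<lambda>_. 1) i = 1"
  by (rule antisym) (auto simp: pmin_le_1 le_pmin_iff)

lemma val_Ev: "v (Ev a) \<pi> = (SUP i. v a (sfx \<pi> i))"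
  by (simp add: Ev_def min.absorb1 val_range)

lemma bdd_val: "bdd_above (range (\<lambda>i. v a (sfx \<pi> i)))"
  by (rule bdd_aboveI2[of _ _ 1]) (rule val_range)

text \<open>A supremum strictly exceeds a bound iff some member does. The strict threshold thus lets
  \<open>Ev\<close> act as an existential quantifier even on formulas that are not Boolean.\<close>

lemma sat_Ev: "sat (Ev a) \<pi> \<longleftrightarrow> (\<exists>i. sat a (sfx \<pi> i))"
  unfolding sat_def val_Ev by (subst less_cSUP_iff) (auto simp: bdd_val)

lemma bool_val_sat: "bool_val a P \<Longrightarrow> sat a \<pi> \<longleftrightarrow> P \<pi>"
  by (auto simp: sat_def bool_val_def)

lemma bool_val_Neg: "bool_val a P \<Longrightarrow> bool_val (Neg a) (\<lambda>\<pi>. \<not> P \<pi>)"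
  by (auto simp: bool_val_def)

lemma bool_val_Or: "bool_val a P \<Longrightarrow> bool_val b Q \<Longrightarrow> bool_val (Or a b) (\<lambda>\<pi>. P \<pi> \<or> Q \<pi>)"
  by (auto simp: bool_val_def)

lemma bool_val_And: "bool_val a P \<Longrightarrow> bool_val b Q \<Longrightarrow> bool_val (And a b) (\<lambda>\<pi>. P \<pi> \<and> Q \<pi>)"
  by (auto simp: bool_val_def val_And)

lemma bool_val_Prop: "bool_val (Prop p) (\<lambda>\<pi>. p \<in> \<pi> 0)"
  by (auto simp: bool_val_def)

lemma bool_val_Next: "bool_val a P \<Longrightarrow> bool_val (Next a) (\<lambda>\<pi>. P (sfx \<pi> 1))"
  by (auto simp: bool_val_def)

lemma bool_val_Disj:
  "(\<And>x. x \<in> set xs \<Longrightarrow> bool_val (f x) (P x)) \<Longrightarrow>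
   bool_val (Disj (map f xs)) (\<lambda>\<pi>. \<exists>x\<in>set xs. P x \<pi>)"
  by (induction xs) (auto simp: bool_val_def)

lemma bool_val_Ev:
  assumes "bool_val a P"
  shows "bool_val (Ev a) (\<lambda>\<pi>. \<exists>i. P (sfx \<pi> i))"
  unfolding bool_val_def
proof
  fix \<pi>
  have v: "v a (sfx \<pi> i) = of_bool (P (sfx \<pi> i))" for i using assms by (auto simp: bool_val_def)
  show "v (Ev a) \<pi> = of_bool (\<exists>i. P (sfx \<pi> i))"
  proof (cases "\<exists>i. P (sfx \<pi> i)")
    case True
    then obtain i where "P (sfx \<pi> i)" by blast
    then show ?thesis unfolding val_Ev using True by (intro SUP_real_eqI[of _ _ i]) (auto simp: v)
  qed (auto simp: val_Ev v)
qed

text \<open>A Boolean guard turns the undiscounted until into a remote read of an arbitrary value.\<close>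

lemma val_Until_first:
  assumes "bool_val m P"
  shows "v (Until (Neg m) (And m a)) \<pi> =
    (if \<exists>i. P (sfx \<pi> i) then v a (sfx \<pi> (LEAST i. P (sfx \<pi> i))) else 0)"
proof -
  have m: "v m (sfx \<pi> i) = of_bool (P (sfx \<pi> i))" for i using assms by (auto simp: bool_val_def)
  define f where "f i = min (min (of_bool (P (sfx \<pi> i))) (v a (sfx \<pi> i)))
    (pmin (\<lambda>j. 1 - of_bool (P (sfx \<pi> j))) i)" for i
  have f: "v (Until (Neg m) (And m a)) \<pi> = (SUP i. f i)" by (simp add: f_def val_And m)
  have zero: "f i \<le> 0" if "\<not> P (sfx \<pi> i)" for i using that by (simp add: f_def min.coboundedI1)
  show ?thesis
  proof (cases "\<exists>i. P (sfx \<pi> i)")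
    case True
    define k where "k = (LEAST i. P (sfx \<pi> i))"
    have k: "P (sfx \<pi> k)" "\<And>j. j < k \<Longrightarrow> \<not> P (sfx \<pi> j)"
      using True LeastI_ex not_less_Least unfolding k_def by metis+
    have "pmin (\<lambda>j. 1 - of_bool (P (sfx \<pi> j))) k = 1"
      by (rule antisym) (auto simp: pmin_le_1 le_pmin_iff k(2))
    then have fk: "f k = v a (sfx \<pi> k)" using k(1) val_range by (simp add: f_def)
    \<comment> \<open>Before \<open>k\<close> the right argument of the until has the value
      \<open>0\<close>; after \<open>k\<close> the left argument has been \<open>0\<close> at
      \<open>k\<close>, which caps the term.\<close>
    have "f i \<le> v a (sfx \<pi> k)" for i
    proof (cases i k rule: linorder_cases)
      case less
      then show ?thesis using zero[of i] k(2) val_range(1)[of a "sfx \<pi> k"] by auto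
    next
      case greater
      have "f i \<le> 0" using pmin_le[OF greater, of "\<lambda>j. 1 - of_bool (P (sfx \<pi> j))"] k(1)
        by (simp add: f_def min.coboundedI2)
      then show ?thesis using val_range(1)[of a "sfx \<pi> k"] by simp
    qed (use fk in simp)
    then have "(SUP i. f i) = v a (sfx \<pi> k)" using fk by (rule SUP_real_eqI)
    then show ?thesis using True unfolding f by (simp add: k_def)
  next
    case False
    have "0 \<le> f 0" using val_range by (simp add: f_def le_pmin_iff)
    then have "(SUP i. f i) = 0"
      using zero False by (intro SUP_real_eqI[of _ _ 0]) (auto intro: antisym)
    then show ?thesis using False unfolding f by simp
  qed
qed

text \<open>Since the discount decreases, the left argument \<open>FTrue\<close> never caps a term,
  and the supremum is attained at the first position satisfying \<open>b\<close>.\<close>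

lemma val_DUntil_first:
  assumes "bool_val b P"
  shows "v (DUntil l FTrue b) \<pi> =
    (if \<exists>i. P (sfx \<pi> i) then \<iota> l (LEAST i. P (sfx \<pi> i)) else 0)"
proof -
  have b: "v b (sfx \<pi> i) = of_bool (P (sfx \<pi> i))" for i using assms by (auto simp: bool_val_def)
  have "\<iota> l i * of_bool (P (sfx \<pi> i)) \<le> pmin (\<lambda>j. \<iota> l j) i" for i
    using disc_range disc_le by (auto simp: le_pmin_iff)
  then have f: "v (DUntil l FTrue b) \<pi> = (SUP i. \<iota> l i * of_bool (P (sfx \<pi> i)))"
    by (simp add: b min.absorb1)
  show ?thesis
  proof (cases "\<exists>i. P (sfx \<pi> i)")
    case True
    define k where "k = (LEAST i. P (sfx \<pi> i))"
    have k: "P (sfx \<pi> k)" using True LeastI_ex unfolding k_def by metis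
    have "\<iota> l i * of_bool (P (sfx \<pi> i)) \<le> \<iota> l k" for i
      using disc_range disc_le[of k i] Least_le[of "\<lambda>i. P (sfx \<pi> i)" i] by (auto simp: k_def)
    then have "(SUP i. \<iota> l i * of_bool (P (sfx \<pi> i))) = \<iota> l k"
      using k by (intro SUP_real_eqI[of _ _ k]) auto
    then show ?thesis using True unfolding f by (simp add: k_def)
  qed (simp add: f del: val.simps)
qed

end

subsection \<open>Words describing runs\<close>

text \<open>Letters are decoded as follows: \<open>0\<close> marks the final configuration, \<open>2 * e + 2\<close> a configuration
  that is left along the edge number \<open>e\<close>, and register \<open>x\<close> has at position \<open>i\<close> the value \<open>d\<close> for which
  \<open>i + 1 + d\<close> is the next position carrying \<open>2 * x + 1\<close>.\<close>

primrec trm_reg :: "trm \<Rightarrow> nat" where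
  "trm_reg TZero = 0"
| "trm_reg (Cur x) = x"
| "trm_reg (CurS x) = x"
| "trm_reg (Nxt x) = x"
| "trm_reg (NxtS x) = x"

locale machine =
  fixes es :: "'q edge list" and p0 qf :: 'q and K :: nat
  assumes edge_regs: "(p, Some a, q) \<in> set es \<Longrightarrow> t \<in> fst ` set a \<union> snd ` set a \<Longrightarrow> trm_reg t < K"
    and K_pos: "0 < K"
begin

definition src :: "nat \<Rightarrow> 'q" where "src e = fst (es ! e)"
definition dst :: "nat \<Rightarrow> 'q" where "dst e = snd (snd (es ! e))"
text \<open>\<open>None\<close> becomes equality on the registers below \<open>K\<close>, the only
  ones that a word records.\<close>

definition eqs :: "nat \<Rightarrow> (trm \<times> trm) list" where
  "eqs e = (case fst (snd (es ! e)) of None \<Rightarrow> map (\<lambda>z. (Nxt z, Cur z)) [0..<K] | Some a \<Rightarrow> a)"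

lemma eqs_regs:
  assumes "e < length es" "t \<in> fst ` set (eqs e) \<union> snd ` set (eqs e)"
  shows "trm_reg t < K"
proof (cases "fst (snd (es ! e))")
  case None
  then show ?thesis using assms(2) by (auto simp: eqs_def)
next
  case (Some a)
  then have "(fst (es ! e), Some a, snd (snd (es ! e))) \<in> set es"
    using nth_mem[OF assms(1)] by (metis prod.collapse)
  then show ?thesis by (rule edge_regs) (use assms(2) Some in \<open>simp add: eqs_def\<close>)
qed

text \<open>The mark \<open>0\<close> takes precedence, so a final configuration owes no further
  step even if it carries edge marks. A position may carry several edge marks;
  \<open>accepted\<close> then requires a correct step for each.\<close>

definition at_edge :: "nat \<Rightarrow> nat set \<Rightarrow> bool" where
  "at_edge e X \<longleftrightarrow> 2 * e + 2 \<in> X \<and> 0 \<notin> X"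

definition config :: "nat set \<Rightarrow> bool" where
  "config X \<longleftrightarrow> 0 \<in> X \<or> (\<exists>e<length es. at_edge e X)"

definition in_state :: "'q \<Rightarrow> nat set \<Rightarrow> bool" where
  "in_state q X \<longleftrightarrow> q = qf \<and> 0 \<in> X \<or> (\<exists>e<length es. src e = q \<and> at_edge e X)"

definition next_config :: "(nat \<Rightarrow> nat set) \<Rightarrow> nat \<Rightarrow> nat" where
  "next_config \<pi> i = i + 1 + (LEAST k. config (\<pi> (i + 1 + k)))"

text \<open>The default \<open>0\<close> from \<open>K\<close> on makes decoded states equal as soon
  as they agree on the registers below \<open>K\<close>.\<close>

definition reg :: "(nat \<Rightarrow> nat set) \<Rightarrow> nat \<Rightarrow> nat \<Rightarrow> nat" where
  "reg \<pi> i x = (if x < K then LEAST k. 2 * x + 1 \<in> \<pi> (i + 1 + k) else 0)"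

text \<open>Excluding the marker at \<open>i\<close> itself makes the distance measured from
  \<open>i\<close> exactly one more than the register value; the successor terms rely on
  this.\<close>

definition regs_ok :: "(nat \<Rightarrow> nat set) \<Rightarrow> nat \<Rightarrow> bool" where
  "regs_ok \<pi> i \<longleftrightarrow> (\<forall>x<K. 2 * x + 1 \<notin> \<pi> i \<and> (\<exists>j. 2 * x + 1 \<in> \<pi> (i + j)))"

text \<open>The required \<open>0\<close> mark rules out infinite runs. No layout is prescribed: a
  marker may even lie beyond the next configuration, as only the decoded values matter.\<close>

definition accepted :: "(nat \<Rightarrow> nat set) \<Rightarrow> bool" where
  "accepted \<pi> \<longleftrightarrow> in_state p0 (\<pi> 0) \<and> (\<exists>h. 0 \<in> \<pi> h) \<and> (\<forall>i. config (\<pi> i) \<longrightarrow> regs_ok \<pi> i) \<and>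
     (\<forall>i. \<forall>e<length es. at_edge e (\<pi> i) \<longrightarrow>
        (\<exists>k. config (\<pi> (i + 1 + k))) \<and> in_state (dst e) (\<pi> (next_config \<pi> i)) \<and>
        holds (eqs e) (reg \<pi> i) (reg \<pi> (next_config \<pi> i)))"

section \<open>Formulas detecting local defects\<close>

definition FEdge :: "nat \<Rightarrow> form" where
  "FEdge e = And (Prop (2 * e + 2)) (Neg (Prop 0))"

definition FConfig :: form where
  "FConfig = Or (Prop 0) (Disj (map FEdge [0..<length es]))"

definition FState :: "'q \<Rightarrow> form" where
  "FState q = Disj (map FEdge (filter (\<lambda>e. src e = q) [0..<length es])
     @ map Prop (if q = qf then [0] else []))"

definition FNext :: "form \<Rightarrow> form" where
  "FNext a = Next (Until (Neg FConfig) (And FConfig a))"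

text \<open>A term denoting \<open>d\<close> is rendered by a formula of value
  \<open>\<iota> 0 d\<close>. Dropping the inner \<open>Next\<close> starts the measurement one
  position earlier and so expresses the successor; zero is the distance to a formula that holds at
  once.\<close>

primrec FTrm :: "trm \<Rightarrow> form" where
  "FTrm TZero = DUntil 0 FTrue FTrue"
| "FTrm (Cur x) = DUntil 0 FTrue (Next (Prop (2 * x + 1)))"
| "FTrm (CurS x) = DUntil 0 FTrue (Prop (2 * x + 1))"
| "FTrm (Nxt x) = FNext (DUntil 0 FTrue (Next (Prop (2 * x + 1))))"
| "FTrm (NxtS x) = FNext (DUntil 0 FTrue (Prop (2 * x + 1)))"

definition FReg :: "nat \<Rightarrow> form" where
  "FReg x = And FConfig (Or (Prop (2 * x + 1)) (Neg (Ev (Prop (2 * x + 1)))))"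

definition FDiffer :: "(trm \<times> trm) \<Rightarrow> form" where
  "FDiffer = (\<lambda>(t, u). Or (Gt (FTrm t) (FTrm u)) (Gt (FTrm u) (FTrm t)))"

text \<open>\<open>FNext\<close> has the value \<open>0\<close> if no configuration follows, so its
  negation covers both a missing next configuration and one in a wrong state.\<close>

definition FStep :: "nat \<Rightarrow> form" where
  "FStep e = And (FEdge e) (Or (Neg (FNext (FState (dst e)))) (Disj (map FDiffer (eqs e))))"

definition Violation :: form where
  "Violation = Or (Neg (FState p0)) (Or (Neg (Ev (Prop 0)))
     (Ev (Or (Disj (map FReg [0..<K])) (Disj (map FStep [0..<length es])))))"

end

section \<open>Values of the defect formulas\<close>

locale discounted_machine = discounted \<iota> + machine es p0 qf K
  for \<iota> :: "nat \<Rightarrow> nat \<Rightarrow> real" and es :: "'q edge list" and p0 qf K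
begin

lemma bool_val_FEdge: "bool_val (FEdge e) (\<lambda>\<pi>. at_edge e (\<pi> 0))"
  unfolding FEdge_def at_edge_def by (intro bool_val_And bool_val_Neg bool_val_Prop)

lemma bool_val_FConfig: "bool_val FConfig (\<lambda>\<pi>. config (\<pi> 0))"
proof -
  have "bool_val FConfig (\<lambda>\<pi>. 0 \<in> \<pi> 0 \<or> (\<exists>e\<in>set [0..<length es]. at_edge e (\<pi> 0)))"
    unfolding FConfig_def by (intro bool_val_Or bool_val_Prop bool_val_Disj bool_val_FEdge)
  then show ?thesis by (auto simp: bool_val_def config_def Bex_def)
qed

lemma bool_val_FState: "bool_val (FState q) (\<lambda>\<pi>. in_state q (\<pi> 0))"
proof -
  have append: "v (Disj (as @ bs)) \<pi> = max (v (Disj as) \<pi>) (v (Disj bs) \<pi>)" for as bs \<pi>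
    by (induction as) (auto simp: val_range max.absorb2 max.assoc)
  have "bool_val (Disj (map FEdge (filter (\<lambda>e. src e = q) [0..<length es])))
    (\<lambda>\<pi>. \<exists>e\<in>set (filter (\<lambda>e. src e = q) [0..<length es]). at_edge e (\<pi> 0))"
    by (intro bool_val_Disj bool_val_FEdge)
  moreover have "bool_val (Disj (map Prop (if q = qf then [0] else [])))
    (\<lambda>\<pi>. \<exists>p\<in>set (if q = qf then [0] else []). p \<in> \<pi> 0)"
    by (intro bool_val_Disj bool_val_Prop)
  ultimately show ?thesis
    by (auto simp: bool_val_def in_state_def FState_def append Bex_def)
qed

lemma val_FNext:
  "v (FNext a) (sfx \<pi> i) =
     (if \<exists>k. config (\<pi> (i + 1 + k)) then v a (sfx \<pi> (next_config \<pi> i)) else 0)"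
  unfolding FNext_def val.simps(5) val_Until_first[OF bool_val_FConfig]
  by (simp add: next_config_def)

lemma val_Cur:
  assumes "regs_ok \<pi> i" "x < K"
  shows "v (DUntil 0 FTrue (Next (Prop (2 * x + 1)))) (sfx \<pi> i) = \<iota> 0 (reg \<pi> i x)"
    and "v (DUntil 0 FTrue (Prop (2 * x + 1))) (sfx \<pi> i) = \<iota> 0 (Suc (reg \<pi> i x))"
proof -
  obtain j where j: "2 * x + 1 \<in> \<pi> (i + j)" and 0: "2 * x + 1 \<notin> \<pi> i"
    using assms by (auto simp: regs_ok_def)
  have "j \<noteq> 0" using j 0 by (metis add.right_neutral)
  then obtain d where d: "j = Suc d" by (cases j) auto
  have 1: "(LEAST k. 2 * x + 1 \<in> \<pi> (i + k)) = Suc (LEAST k. 2 * x + 1 \<in> \<pi> (i + Suc k))"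
    by (rule Least_Suc[of "\<lambda>k. 2 * x + 1 \<in> \<pi> (i + k)", OF j]) (use 0 in simp)
  show "v (DUntil 0 FTrue (Next (Prop (2 * x + 1)))) (sfx \<pi> i) = \<iota> 0 (reg \<pi> i x)"
    unfolding val_DUntil_first[OF bool_val_Next[OF bool_val_Prop]]
    using j d assms(2) by (auto simp: reg_def)
  show "v (DUntil 0 FTrue (Prop (2 * x + 1))) (sfx \<pi> i) = \<iota> 0 (Suc (reg \<pi> i x))"
    unfolding val_DUntil_first[OF bool_val_Prop]
    using j 1 assms(2) by (auto simp: reg_def)
qed

lemma next_config: "config (\<pi> (i + 1 + k)) \<Longrightarrow> config (\<pi> (next_config \<pi> i))"
  unfolding next_config_def by (rule LeastI)

lemma val_FTrm:
  assumes "trm_reg t < K" "regs_ok \<pi> i" "regs_ok \<pi> (next_config \<pi> i)"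
    "config (\<pi> (i + 1 + k))"
  shows "v (FTrm t) (sfx \<pi> i) = \<iota> 0 (teval t (reg \<pi> i) (reg \<pi> (next_config \<pi> i)))"
proof (cases t)
  case TZero
  have "bool_val FTrue (\<lambda>_. True)" by (simp add: bool_val_def)
  from val_DUntil_first[OF this] show ?thesis using TZero by simp
next
  case (Nxt x)
  then show ?thesis using assms val_Cur(1)[of \<pi> "next_config \<pi> i" x]
    by (auto simp: val_FNext)
next
  case (NxtS x)
  then show ?thesis using assms val_Cur(2)[of \<pi> "next_config \<pi> i" x]
    by (auto simp: val_FNext)
qed (use assms val_Cur[of \<pi> i "trm_reg t"] in auto)

end

lemma holds_cong:
  assumes "\<And>u. u \<in> fst ` set a \<union> snd ` set a \<Longrightarrow> teval u s s' = teval u r r'"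
  shows "holds a s s' \<longleftrightarrow> holds a r r'"
  unfolding holds_def
proof (rule ball_cong[OF refl])
  fix x assume "x \<in> set a"
  then have "teval (fst x) s s' = teval (fst x) r r'" "teval (snd x) s s' = teval (snd x) r r'"
    by (intro assms; blast)+
  then show "(case x of (t, u) \<Rightarrow> teval t s s' = teval u s s') \<longleftrightarrow>
    (case x of (t, u) \<Rightarrow> teval t r r' = teval u r r')"
    by (simp add: case_prod_beta)
qed

section \<open>Accepted words and terminating runs\<close>

context machine begin

text \<open>Position \<open>h\<close> is itself a configuration, so \<open>next_config\<close>
  cannot jump over it. The decoded configurations therefore move towards \<open>h\<close>, and the
  run ends at a \<open>0\<close> mark no later than \<open>h\<close>.\<close>

lemma reaches_final:
  assumes acc: "accepted \<pi>" and h: "0 \<in> \<pi> h"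
  shows "i \<le> h \<Longrightarrow> in_state q (\<pi> i) \<Longrightarrow> \<exists>s'. ((q, reg \<pi> i), (qf, s')) \<in> (step es)\<^sup>*"
proof (induction "h - i" arbitrary: i q rule: less_induct)
  case less
  show ?case
  proof (cases "0 \<in> \<pi> i")
    case True
    then have "q = qf" using less.prems(2) by (auto simp: in_state_def at_edge_def)
    then show ?thesis by blast
  next
    case False
    then obtain e where e: "e < length es" "src e = q" "at_edge e (\<pi> i)"
      using less.prems(2) by (auto simp: in_state_def)
    let ?j = "next_config \<pi> i"
    have j: "in_state (dst e) (\<pi> ?j)" "holds (eqs e) (reg \<pi> i) (reg \<pi> ?j)"
      using acc e by (auto simp: accepted_def)
    have "i < h" using False less.prems(1) h by (cases "i = h") auto
    then have "h = i + 1 + (h - i - 1)" by simp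
    then have "(LEAST k. config (\<pi> (i + 1 + k))) \<le> h - i - 1"
      using h by (intro Least_le) (simp add: config_def)
    then have "i < ?j" "?j \<le> h" using \<open>i < h\<close> by (auto simp: next_config_def)
    then obtain s' where s': "((dst e, reg \<pi> ?j), (qf, s')) \<in> (step es)\<^sup>*"
      using less.hyps[of ?j "dst e"] j(1) \<open>i < h\<close> by (auto simp: diff_less_mono2)
    have "action (fst (snd (es ! e))) (reg \<pi> i) (reg \<pi> ?j)"
    proof (cases "fst (snd (es ! e))")
      case None
      then have "\<forall>x<K. reg \<pi> ?j x = reg \<pi> i x" using j(2) by (auto simp: eqs_def)
      then have "reg \<pi> ?j = reg \<pi> i" by (auto simp: reg_def fun_eq_iff)
      then show ?thesis using None by simp
    next
      case (Some a)
      then show ?thesis using j(2) by (simp add: eqs_def)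
    qed
    moreover have "(q, fst (snd (es ! e)), dst e) \<in> set es"
      using nth_mem[OF e(1)] unfolding e(2)[symmetric] src_def dst_def by simp
    ultimately have "((q, reg \<pi> i), (dst e, reg \<pi> ?j)) \<in> step es" by (auto simp: step_def)
    then show ?thesis using s' by (meson converse_rtrancl_into_rtrancl)
  qed
qed

text \<open>The run is laid out in blocks of a common width \<open>W\<close>: configuration
  \<open>t\<close> stands at \<open>t * W\<close>, and its register markers lie strictly inside the
  block.\<close>

lemma accepted_word:
  assumes path: "((p0, s), (qf, s')) \<in> (step es)\<^sup>*"
  obtains \<pi> where "accepted \<pi>" "\<forall>x<K. reg \<pi> 0 x = s x"
proof -
  from path obtain L c where c: "c 0 = (p0, s)" "c L = (qf, s')"
    "\<And>t. t < L \<Longrightarrow> (c t, c (Suc t)) \<in> step es"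
    unfolding rtrancl_power relpow_fun_conv by blast
  define st where "st t = fst (c t)" for t
  define rg where "rg t = snd (c t)" for t
  have "\<exists>e. e < length es \<and> src e = st t \<and> dst e = st (Suc t) \<and>
    action (fst (snd (es ! e))) (rg t) (rg (Suc t))" if t: "t < L" for t
  proof -
    obtain a where "(st t, a, st (Suc t)) \<in> set es" "action a (rg t) (rg (Suc t))"
      using c(3)[OF t] by (auto simp: step_def st_def rg_def case_prod_beta)
    then show ?thesis unfolding in_set_conv_nth by (auto simp: src_def dst_def)
  qed
  then obtain ed where ed: "\<And>t. t < L \<Longrightarrow> ed t < length es \<and> src (ed t) = st t \<and>
    dst (ed t) = st (Suc t) \<and> action (fst (snd (es ! ed t))) (rg t) (rg (Suc t))"
    by metis
  \<comment> \<open>The summand \<open>2\<close> keeps the marker offset \<open>rg t x + 1\<close>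
    below \<open>W\<close>, so each marker precedes the next block.\<close>
  define W where "W = Max ((\<lambda>(t, x). rg t x) ` ({..L} \<times> {..<K})) + 2"
  have W: "rg t x + 1 < W" if "t \<le> L" "x < K" for t x
  proof -
    have "rg t x \<le> W - 2" unfolding W_def using that by simp (intro Max_ge, auto)
    then show ?thesis by (simp add: W_def)
  qed
  have W2: "W > 1" by (simp add: W_def)
  have split: "t = t' \<and> a = a'" if "t * W + a = t' * W + a'" "a < W" "a' < W" for t t' a a'
    using that
    by (metis add.commute div_mult_self3 mod_mult_self3 div_less mod_less add_0 not_less_zero)
  define \<pi> where "\<pi> i = {p. p = 0 \<and> i = L * W \<or> (\<exists>t<L. p = 2 * ed t + 2 \<and> i = t * W) \<or>
    (\<exists>x<K. \<exists>t\<le>L. p = 2 * x + 1 \<and> i = t * W + (rg t x + 1))}" for i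
  have final: "0 \<in> \<pi> i \<longleftrightarrow> i = L * W" for i by (simp add: \<pi>_def)
  have edge: "at_edge e (\<pi> i) \<longleftrightarrow> (\<exists>t<L. e = ed t \<and> i = t * W)" for e i
  proof -
    have "2 * e + 2 \<noteq> 2 * x + 1" for x by presburger
    then show ?thesis unfolding at_edge_def using W2 by (auto simp: \<pi>_def)
  qed
  have marker: "2 * x + 1 \<in> \<pi> i \<longleftrightarrow> (\<exists>t\<le>L. i = t * W + (rg t x + 1))" if "x < K" for x i
  proof -
    have "2 * x + 1 \<noteq> 2 * e + 2" for e by presburger
    then show ?thesis unfolding \<pi>_def using that by auto
  qed
  have cfg: "config (\<pi> i) \<longleftrightarrow> (\<exists>t\<le>L. i = t * W)" for i
    unfolding config_def final edge using ed by (auto simp: le_less)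
  have state: "in_state (st t) (\<pi> (t * W))" if "t \<le> L" for t
  proof (cases "t = L")
    case True
    then show ?thesis using c(2) by (simp add: in_state_def final st_def)
  next
    case False
    then have t: "t < L" using that by simp
    then have "\<exists>t'<L. ed t = ed t' \<and> t * W = t' * W" by blast
    then show ?thesis unfolding in_state_def edge using ed[OF t] by blast
  qed
  have ok: "regs_ok \<pi> (t * W)" if "t \<le> L" for t
    unfolding regs_ok_def
  proof (intro allI impI conjI)
    fix x assume x: "x < K"
    show "2 * x + 1 \<notin> \<pi> (t * W)"
      unfolding marker[OF x] using split[of t 0 _ "rg _ x + 1"] W[OF _ x] W2 by fastforce
    show "\<exists>j. 2 * x + 1 \<in> \<pi> (t * W + j)"
      unfolding marker[OF x] using that by blast
  qed
  have reg: "reg \<pi> (t * W) x = rg t x" if t: "t \<le> L" and x: "x < K" for t x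
  proof -
    have "(LEAST k. 2 * x + 1 \<in> \<pi> (t * W + 1 + k)) = rg t x"
    proof (rule Least_equality)
      show "2 * x + 1 \<in> \<pi> (t * W + 1 + rg t x)"
        unfolding marker[OF x] using t by (intro exI[of _ t]) simp
      fix k assume "2 * x + 1 \<in> \<pi> (t * W + 1 + k)"
      then obtain t' where t': "t' \<le> L" "t * W + 1 + k = t' * W + (rg t' x + 1)"
        unfolding marker[OF x] by blast
      \<comment> \<open>A marker of an earlier block lies before \<open>t * W\<close>, and one of a
        later block lies beyond the marker of block \<open>t\<close>.\<close>
      consider "t' = t" | "Suc t' \<le> t" | "Suc t \<le> t'" by linarith
      then show "rg t x \<le> k"
      proof cases
        case 2
        then have "Suc t' * W \<le> t * W" by (rule mult_le_mono1)
        then show ?thesis using t'(2) W[OF t'(1) x] by simp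
      next
        case 3
        then have "Suc t * W \<le> t' * W" by (rule mult_le_mono1)
        then show ?thesis using t'(2) W[OF t x] by simp
      qed (use t' in simp)
    qed
    then show ?thesis using x by (simp add: reg_def)
  qed
  have nxt: "next_config \<pi> (t * W) = Suc t * W" if "t < L" for t
  proof -
    have "(LEAST k. config (\<pi> (t * W + 1 + k))) = W - 1"
    proof (rule Least_equality)
      show "config (\<pi> (t * W + 1 + (W - 1)))"
        unfolding cfg using that W2 by (intro exI[of _ "Suc t"]) simp
      fix k assume "config (\<pi> (t * W + 1 + k))"
      then obtain t' where t': "t * W + 1 + k = t' * W" unfolding cfg by blast
      then have "t * W < t' * W" by linarith
      then have "t < t'" by simp
      then have "Suc t * W \<le> t' * W" by (intro mult_le_mono1) simp
      then show "W - 1 \<le> k" using t' by simp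
    qed
    then show ?thesis using W2 by (simp add: next_config_def)
  qed
  have "accepted \<pi>"
    unfolding accepted_def
  proof (intro conjI allI impI)
    show "in_state p0 (\<pi> 0)" using state[of 0] c(1) by (simp add: st_def)
    show "\<exists>h. 0 \<in> \<pi> h" by (simp add: final)
    show "regs_ok \<pi> i" if "config (\<pi> i)" for i using that ok cfg by auto
    fix i e assume "e < length es" "at_edge e (\<pi> i)"
    then obtain t where t: "t < L" "e = ed t" "i = t * W" using edge by auto
    have "config (\<pi> (i + 1 + (W - 1)))"
      unfolding cfg using t W2 by (intro exI[of _ "Suc t"]) simp
    then show "\<exists>k. config (\<pi> (i + 1 + k))" ..
    show "in_state (dst e) (\<pi> (next_config \<pi> i))"
      using nxt[OF t(1)] t ed[of t] state[of "Suc t"] by simp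
    \<comment> \<open>\<open>rg\<close> and the decoded registers may differ from \<open>K\<close>
      on, but \<open>eqs e\<close> mentions only registers below \<open>K\<close>.\<close>
    have "teval u (reg \<pi> i) (reg \<pi> (next_config \<pi> i)) = teval u (rg t) (rg (Suc t))"
      if "trm_reg u < K" for u
      using that reg[of t] reg[of "Suc t"] t nxt[OF t(1)] by (cases u) auto
    then have "teval u (reg \<pi> i) (reg \<pi> (next_config \<pi> i)) = teval u (rg t) (rg (Suc t))"
      if "u \<in> fst ` set (eqs e) \<union> snd ` set (eqs e)" for u
      using that eqs_regs[OF \<open>e < length es\<close>] by blast
    then have "holds (eqs e) (reg \<pi> i) (reg \<pi> (next_config \<pi> i)) \<longleftrightarrow>
      holds (eqs e) (rg t) (rg (Suc t))"
      by (rule holds_cong)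
    moreover have "action (fst (snd (es ! e))) (rg t) (rg (Suc t))" using ed[OF t(1)] t(2) by simp
    then have "holds (eqs e) (rg t) (rg (Suc t))"
      by (cases "fst (snd (es ! e))") (simp_all add: eqs_def)
    ultimately show "holds (eqs e) (reg \<pi> i) (reg \<pi> (next_config \<pi> i))" by blast
  qed
  moreover have "\<forall>x<K. reg \<pi> 0 x = s x"
    using reg[of 0] c(1) by (auto simp: rg_def)
  ultimately show thesis by (rule that)
qed

end

section \<open>Semantics of the violation formula\<close>

context discounted_machine begin

text \<open>Term formulas are known to have their intended values only where \<open>regs_ok\<close>
  holds at both configurations involved. This suffices, because any configuration breaching
  \<open>regs_ok\<close> is a defect by itself.\<close>

lemma sat_Violation:
  shows "\<not> sat Violation \<pi> \<longleftrightarrow> accepted \<pi>"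
proof -
  have 1: "sat (Neg (FState p0)) \<pi> \<longleftrightarrow> \<not> in_state p0 (\<pi> 0)"
    using bool_val_sat[OF bool_val_Neg[OF bool_val_FState]] .
  have 2: "sat (Neg (Ev (Prop 0))) \<pi> \<longleftrightarrow> \<not> (\<exists>h. 0 \<in> \<pi> h)"
    using bool_val_sat[OF bool_val_Neg[OF bool_val_Ev[OF bool_val_Prop]]] by simp
  have 3: "sat (FReg x) (sfx \<pi> i) \<longleftrightarrow>
    config (\<pi> i) \<and> (2 * x + 1 \<in> \<pi> i \<or> \<not> (\<exists>j. 2 * x + 1 \<in> \<pi> (i + j)))" for i x
    unfolding FReg_def
    using bool_val_sat[OF bool_val_And[OF bool_val_FConfig bool_val_Or[OF bool_val_Prop
            bool_val_Neg[OF bool_val_Ev[OF bool_val_Prop]]]], of "2 * x + 1" "2 * x + 1" "sfx \<pi> i"]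
    by simp
  have edge: "sat (FEdge e) (sfx \<pi> i) \<longleftrightarrow> at_edge e (\<pi> i)" for e i
    using bool_val_sat[OF bool_val_FEdge] by simp
  have next_state: "sat (Neg (FNext (FState q))) (sfx \<pi> i) \<longleftrightarrow>
    \<not> ((\<exists>k. config (\<pi> (i + 1 + k))) \<and> in_state q (\<pi> (next_config \<pi> i)))" for q i
    using bool_val_FState[of q] unfolding sat_def val.simps(3) val_FNext by (auto simp: bool_val_def)
  have differ: "sat (FDiffer x) (sfx \<pi> i) \<longleftrightarrow>
      v (FTrm (fst x)) (sfx \<pi> i) \<noteq> v (FTrm (snd x)) (sfx \<pi> i)" for x i
    unfolding FDiffer_def case_prod_beta sat_Or sat_Gt by auto
  \<comment> \<open>\<open>agree\<close> compares formula values and so makes sense without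
    \<open>regs_ok\<close>; it is translated into equations between numbers only once well-formed
    registers may be assumed.\<close>
  define agree where "agree i e \<longleftrightarrow>
    (\<forall>(t, u)\<in>set (eqs e). v (FTrm t) (sfx \<pi> i) = v (FTrm u) (sfx \<pi> i))" for i e
  have "(\<exists>a\<in>set (map FDiffer (eqs e)). sat a (sfx \<pi> i)) \<longleftrightarrow> \<not> agree i e" for e i
    by (simp add: differ agree_def case_prod_beta)
  then have 4: "sat (FStep e) (sfx \<pi> i) \<longleftrightarrow> at_edge e (\<pi> i) \<and>
    \<not> ((\<exists>k. config (\<pi> (i + 1 + k))) \<and> in_state (dst e) (\<pi> (next_config \<pi> i)) \<and> agree i e)"
    for e i
    unfolding FStep_def sat_And sat_Or sat_Disj edge next_state by blast
  have 5: "(\<exists>a\<in>set (map FReg [0..<K]). sat a (sfx \<pi> i)) \<longleftrightarrow> config (\<pi> i) \<and> \<not> regs_ok \<pi> i" for i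
    by (auto simp: 3 regs_ok_def)
  have 6: "(\<exists>a\<in>set (map FStep [0..<length es]). sat a (sfx \<pi> i)) \<longleftrightarrow>
    (\<exists>e<length es. sat (FStep e) (sfx \<pi> i))" for i
    by auto
  have "\<not> sat Violation \<pi> \<longleftrightarrow> in_state p0 (\<pi> 0) \<and> (\<exists>h. 0 \<in> \<pi> h) \<and>
    (\<forall>i. config (\<pi> i) \<longrightarrow> regs_ok \<pi> i) \<and>
    (\<forall>i. \<forall>e<length es. at_edge e (\<pi> i) \<longrightarrow>
        (\<exists>k. config (\<pi> (i + 1 + k))) \<and> in_state (dst e) (\<pi> (next_config \<pi> i)) \<and> agree i e)"
    unfolding Violation_def sat_Or sat_Ev sat_Disj 1 2 4 5 6 by blast
  also have "\<dots> \<longleftrightarrow> accepted \<pi>"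
  proof -
    have "agree i e \<longleftrightarrow>
        holds (eqs e) (reg \<pi> i) (reg \<pi> (next_config \<pi> i))"
      if ok: "\<forall>i. config (\<pi> i) \<longrightarrow> regs_ok \<pi> i" and e: "e < length es" "at_edge e (\<pi> i)"
        and ex: "\<exists>k. config (\<pi> (i + 1 + k))" for i e
    proof -
      obtain k where k: "config (\<pi> (i + 1 + k))" using ex by blast
      have "config (\<pi> i)" using e by (auto simp: config_def)
      then have "v (FTrm t) (sfx \<pi> i) = \<iota> 0 (teval t (reg \<pi> i) (reg \<pi> (next_config \<pi> i)))"
        if "trm_reg t < K" for t
        using val_FTrm[of t \<pi> i k] that k next_config[of \<pi> i k] ok by blast
      then have t: "v (FTrm t) (sfx \<pi> i) = \<iota> 0 (teval t (reg \<pi> i) (reg \<pi> (next_config \<pi> i)))"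
        if "t \<in> fst ` set (eqs e) \<union> snd ` set (eqs e)" for t
        using eqs_regs[OF e(1) that] by blast
      show ?thesis unfolding agree_def holds_def
      proof (rule ball_cong[OF refl])
        fix x assume "x \<in> set (eqs e)"
        with t[of "fst x"] t[of "snd x"]
        show "(case x of (t, u) \<Rightarrow> v (FTrm t) (sfx \<pi> i) = v (FTrm u) (sfx \<pi> i)) \<longleftrightarrow>
          (case x of (t, u) \<Rightarrow> teval t (reg \<pi> i) (reg \<pi> (next_config \<pi> i)) =
            teval u (reg \<pi> i) (reg \<pi> (next_config \<pi> i)))"
          by (simp add: case_prod_beta)
      qed
    qed
    then show ?thesis unfolding accepted_def by blast
  qed
  finally show ?thesis .
qed

end

text \<open>\<open>1\<close> is the marker \<open>2 * 0 + 1\<close> of register \<open>0\<close>;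
  the formula rejects just one position for its first occurrence. Nesting \<open>Next\<close> makes
  the code computable by primitive recursion on \<open>n\<close>.\<close>

primrec NotInit :: "nat \<Rightarrow> form" where
  "NotInit 0 = Neg (Prop 1)"
| "NotInit (Suc n) = Or (Prop 1) (Next (NotInit n))"

lemma (in discounted) sat_NotInit:
  "\<not> sat (NotInit n) \<pi> \<longleftrightarrow> 1 \<in> \<pi> n \<and> (\<forall>j<n. 1 \<notin> \<pi> j)"
proof (induction n arbitrary: \<pi>)
  case (Suc n)
  have "\<not> sat (NotInit (Suc n)) \<pi> \<longleftrightarrow> 1 \<notin> \<pi> 0 \<and> \<not> sat (NotInit n) (sfx \<pi> 1)"
    by (auto simp: sat_def)
  then show ?case unfolding Suc.IH by (auto simp: less_Suc_eq_0_disj)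
qed (simp add: sat_def)

text \<open>\<open>Suc n\<close> appears because the initial registers are read from position
  \<open>1\<close> on. Words falsifying both disjuncts are the accepted words with input
  \<open>n\<close>, so \<open>reaches_final\<close> and \<open>accepted_word\<close> give the two
  directions.\<close>

lemma (in discounted_machine) falsifiable_iff_reachable:
  shows "(\<exists>\<pi>. \<not> sat (Or Violation (NotInit (Suc n))) \<pi>) \<longleftrightarrow>
    (\<exists>s s'. s 0 = n \<and> ((p0, s), (qf, s')) \<in> (step es)\<^sup>*)"
proof -
  have init: "\<not> sat (NotInit (Suc n)) \<pi> \<longleftrightarrow> reg \<pi> 0 0 = n" if acc: "accepted \<pi>" for \<pi>
  proof -
    have "config (\<pi> 0)" using acc by (auto simp: accepted_def in_state_def config_def)
    then have "regs_ok \<pi> 0" using acc by (auto simp: accepted_def)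
    from this[unfolded regs_ok_def, rule_format, OF K_pos]
    have 0: "1 \<notin> \<pi> 0" and ex: "\<exists>j. 1 \<in> \<pi> j" by auto
    obtain d where d: "1 \<in> \<pi> (Suc d)" using 0 ex by (metis not0_implies_Suc)
    have "(LEAST k. 1 \<in> \<pi> (Suc k)) = n \<longleftrightarrow> 1 \<in> \<pi> (Suc n) \<and> (\<forall>j<n. 1 \<notin> \<pi> (Suc j))"
    proof
      assume "(LEAST k. 1 \<in> \<pi> (Suc k)) = n"
      then show "1 \<in> \<pi> (Suc n) \<and> (\<forall>j<n. 1 \<notin> \<pi> (Suc j))"
        using LeastI[of "\<lambda>k. 1 \<in> \<pi> (Suc k)", OF d] not_less_Least[of _ "\<lambda>k. 1 \<in> \<pi> (Suc k)"]
        by blast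
    next
      assume "1 \<in> \<pi> (Suc n) \<and> (\<forall>j<n. 1 \<notin> \<pi> (Suc j))"
      then show "(LEAST k. 1 \<in> \<pi> (Suc k)) = n"
        by (intro Least_equality) (auto simp: not_less[symmetric])
    qed
    then show ?thesis unfolding sat_NotInit using K_pos 0 by (auto simp: reg_def less_Suc_eq_0_disj)
  qed
  show ?thesis
  proof
    assume "\<exists>\<pi>. \<not> sat (Or Violation (NotInit (Suc n))) \<pi>"
    then obtain \<pi> where \<pi>: "\<not> sat Violation \<pi>" "\<not> sat (NotInit (Suc n)) \<pi>"
      unfolding sat_Or by blast
    then have acc: "accepted \<pi>" using sat_Violation by blast
    then obtain h where "0 \<in> \<pi> h" "in_state p0 (\<pi> 0)" by (auto simp: accepted_def)
    then show "\<exists>s s'. s 0 = n \<and> ((p0, s), (qf, s')) \<in> (step es)\<^sup>*"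
      using reaches_final[OF acc, of h 0 p0] init[OF acc] \<pi>(2) by blast
  next
    assume "\<exists>s s'. s 0 = n \<and> ((p0, s), (qf, s')) \<in> (step es)\<^sup>*"
    then obtain s s' where s: "s 0 = n" "((p0, s), (qf, s')) \<in> (step es)\<^sup>*" by blast
    obtain \<pi> where \<pi>: "accepted \<pi>" "\<forall>x<K. reg \<pi> 0 x = s x"
      using accepted_word[OF s(2)] by blast
    then have "\<not> sat (NotInit (Suc n)) \<pi>" using init K_pos s(1) by blast
    then show "\<exists>\<pi>. \<not> sat (Or Violation (NotInit (Suc n))) \<pi>"
      using \<pi>(1) sat_Violation unfolding sat_Or by blast
  qed
qed

text \<open>\<open>\<theta>\<close> depends on the program only, as the input is tested by
  \<open>NotInit\<close> alone. This uniformity allows \<open>n\<close> to be the code of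
  \<open>\<theta>\<close> itself.\<close>

lemma (in discounted) program_formula:
  "\<exists>\<theta>. \<forall>n. (\<exists>\<pi>. \<not> sat (Or \<theta> (NotInit (Suc n))) \<pi>) \<longleftrightarrow>
    (\<exists>s s'. s 0 = n \<and> (s, s') \<in> sem c)"
proof -
  define es where "es = edges c []"
  \<comment> \<open>\<open>T\<close> collects the terms on all edges; being finite, it has a bound
    \<open>m\<close> on its registers. Taking \<open>Suc m\<close> registers also guarantees that
    there is a register \<open>0\<close>.\<close>
  define T where "T = (\<Union>x\<in>set es. case fst (snd x) of None \<Rightarrow> {} | Some b \<Rightarrow> fst ` set b \<union> snd ` set b)"
  have "finite (trm_reg ` T)"
    unfolding T_def by (intro finite_imageI finite_UN_I) (auto split: option.splits)
  then obtain m where m: "\<And>t. t \<in> T \<Longrightarrow> trm_reg t < m"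
    unfolding finite_nat_set_iff_bounded by auto
  interpret discounted_machine \<iota> es "[c]" "[]" "Suc m"
  proof unfold_locales
    fix p a q t assume "(p, Some a, q) \<in> set es" "t \<in> fst ` set a \<union> snd ` set a"
    then have "t \<in> T" by (force simp: T_def)
    then show "trm_reg t < Suc m" using m by (simp add: less_Suc_eq)
  qed simp
  show ?thesis
    using falsifiable_iff_reachable unfolding es_def step_edges_iff by blast
qed

subsection \<open>Diagonalization\<close>

primrec rconst :: "nat \<Rightarrow> recf" where
  "rconst 0 = Zf"
| "rconst (Suc c) = Cnf Sf [rconst c]"

definition radd :: recf where
  "radd = Prf (Idf 0) (Cnf Sf [Idf 1])"

definition rtriangle :: recf where
  "rtriangle = Prf Zf (Cnf radd [Cnf Sf [Idf 0], Idf 1])"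

text \<open>This follows \<open>prod_encode (x, y) = triangle (x + y) + x\<close>.\<close>

definition rpair :: "recf \<Rightarrow> recf \<Rightarrow> recf" where
  "rpair f g = Cnf radd [Cnf rtriangle [Cnf radd [f, g]], f]"

lemma reval_Cnf1_iff: "reval (Cnf f [g]) xs z \<longleftrightarrow> (\<exists>y. reval g xs y \<and> reval f [y] z)"
  by (auto simp: reval_Cnf_iff list_all2_Cons1)

lemma reval_Cnf1: "reval g xs y \<Longrightarrow> reval f [y] z \<Longrightarrow> reval (Cnf f [g]) xs z"
  by (auto simp: reval_Cnf1_iff)

lemma reval_Cnf2:
  "reval g xs y \<Longrightarrow> reval h xs y' \<Longrightarrow> reval f [y, y'] z \<Longrightarrow> reval (Cnf f [g, h]) xs z"
  by (auto simp: reval_Cnf_iff list_all2_Cons1)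

lemma reval_rconst: "reval (rconst c) xs c"
  by (induction c) (auto intro: reval_Cnf1)

lemma reval_radd: "reval radd [x, y] (x + y)"
  unfolding radd_def by (induction x) (auto intro!: exI reval_Cnf1)

lemma reval_rtriangle: "reval rtriangle [n] (triangle n)"
  unfolding rtriangle_def
proof (induction n)
  case (Suc n)
  have "reval (Cnf radd [Cnf Sf [Idf 0], Idf 1]) [n, triangle n] (Suc n + triangle n)"
    by (rule reval_Cnf2[OF _ _ reval_radd]) (auto intro: reval_Cnf1)
  then show ?case using Suc by (auto simp: add.commute)
qed simp

lemma reval_rpair:
  "reval f xs x \<Longrightarrow> reval g xs y \<Longrightarrow> reval (rpair f g) xs (prod_encode (x, y))"
  unfolding rpair_def prod_encode_def
  by (auto intro!: reval_Cnf2[OF _ _ reval_radd] reval_Cnf1[OF _ reval_rtriangle])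

text \<open>\<open>3\<close> and \<open>4\<close> are the tags of \<open>Or\<close> and
  \<open>Next\<close> in \<open>enc\<close>; \<open>Idf 1\<close> is the code obtained in the
  previous round.\<close>

definition rnotinit :: recf where
  "rnotinit = Prf (rconst (enc (NotInit 0)))
    (rpair (rconst 3) (rpair (rconst (enc (Prop 1))) (rpair (rconst 4) (Idf 1))))"

lemma reval_rnotinit: "reval rnotinit [n] (enc (NotInit n))"
  unfolding rnotinit_def
proof (induction n)
  case 0
  show ?case using reval_rconst[of "enc (NotInit 0)"] by simp
next
  case (Suc n)
  have "reval (rpair (rconst 3) (rpair (rconst (enc (Prop 1))) (rpair (rconst 4) (Idf 1))))
    [n, enc (NotInit n)] (enc (NotInit (Suc n)))"
    unfolding NotInit.simps enc.simps(4,5)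
    by (intro reval_rpair reval_rconst) simp
  then show ?case using Suc by auto
qed

text \<open>The argument is used twice, as the code of the left disjunct and as the input tested by
  \<open>NotInit\<close>; this is the self-reference of the diagonal. The pair \<open>(1, 1)\<close>
  codes the threshold \<open>1 / 2\<close>, its second component being one less than the
  denominator.\<close>

definition rquery :: recf where
  "rquery = rpair (rpair (rconst 3) (rpair (Idf 0) (Cnf rnotinit [Cnf Sf [Idf 0]])))
    (rconst (prod_encode (1, 1)))"

lemma reval_rquery:
  "reval rquery [enc \<theta>] (prod_encode (enc (Or \<theta> (NotInit (Suc (enc \<theta>)))), prod_encode (1, 1)))"
  unfolding rquery_def enc.simps(4)
  by (intro reval_rpair reval_rconst reval_Cnf1[OF _ reval_rnotinit] reval_Cnf1) auto

text \<open>The minimization halts only if its parameter is \<open>0\<close>.\<close>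

definition rdiag :: "recf \<Rightarrow> recf" where
  "rdiag f = Cnf (Mnf (Idf 1)) [Cnf f [rquery]]"

text \<open>By functionality \<open>rquery\<close> yields no value but \<open>m\<close>, so the
  search runs on the answer of \<open>f\<close> to \<open>m\<close>, and only the answer
  \<open>0\<close> lets it stop.\<close>

lemma rdiag_terminates_iff:
  assumes "reval rquery xs m"
  shows "(\<exists>y. reval (rdiag f) xs y) \<longleftrightarrow> reval f [m] 0"
proof -
  have "reval rquery xs m' \<longleftrightarrow> m' = m" for m'
    using assms reval_functional by blast
  then have "reval (Cnf f [rquery]) xs r \<longleftrightarrow> reval f [m] r" for r
    by (simp add: reval_Cnf1_iff)
  moreover have "(\<exists>y. reval (Mnf (Idf 1)) [r] y) \<longleftrightarrow> r = 0" for r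
    by (auto simp: reval_Mnf_iff)
  ultimately show ?thesis unfolding rdiag_def reval_Cnf1_iff by metis
qed

theorem theorem5:
  fixes D :: "(nat \<Rightarrow> real) set" and \<iota> :: "nat \<Rightarrow> nat \<Rightarrow> real"
  assumes "D \<noteq> {}" and "\<forall>\<eta>\<in>D. discounting \<eta>" and "range \<iota> \<subseteq> D"
  shows "\<not> (\<exists>f. decides_validity \<iota> f)"
proof
  assume "\<exists>f. decides_validity \<iota> f"
  then obtain f where f: "decides_validity \<iota> f" ..
  interpret discounted \<iota> by unfold_locales (use assms in blast)
  obtain \<theta> where \<theta>: "\<And>n. (\<exists>\<pi>. \<not> sat (Or \<theta> (NotInit (Suc n))) \<pi>) \<longleftrightarrow>
      (\<exists>s s'. s 0 = n \<and> (s, s') \<in> sem (compile (rdiag f) [0] 1 2))"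
    using program_formula by blast
  \<comment> \<open>The diagonal instance: the machine of \<open>rdiag f\<close> is run on the code
    of the formula \<open>\<theta>\<close> built from that very machine.\<close>
  let ?\<phi> = "Or \<theta> (NotInit (Suc (enc \<theta>)))"
  let ?m = "prod_encode (enc ?\<phi>, prod_encode (1, 1))"
  have "\<not> valid_above \<iota> ?\<phi> (1 / 2) \<longleftrightarrow>
    (\<exists>s s'. s 0 = enc \<theta> \<and> (s, s') \<in> sem (compile (rdiag f) [0] 1 2))"
    using \<theta>[of "enc \<theta>"] by (simp only: valid_above_def sat_def not_all)
  also have "\<dots> \<longleftrightarrow> (\<exists>y. reval (rdiag f) [enc \<theta>] y)"
    using compile_terminates_iff[of _ "enc \<theta>" "rdiag f"] by (metis fun_upd_same)
  also have "\<dots> \<longleftrightarrow> reval f [?m] 0"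
    by (rule rdiag_terminates_iff[OF reval_rquery])
  finally have diag: "\<not> valid_above \<iota> ?\<phi> (1 / 2) \<longleftrightarrow> reval f [?m] 0" .
  have "(valid_above \<iota> ?\<phi> (1 / 2) \<longrightarrow> reval f [?m] 0) \<and>
    (\<not> valid_above \<iota> ?\<phi> (1 / 2) \<longrightarrow> reval f [?m] 1)"
    using f[unfolded decides_validity_def, rule_format, of 1 1 ?\<phi>]
    by (simp only: Let_def) simp
  \<comment> \<open>If the formula is valid, the answer \<open>0\<close> contradicts
    \<open>diag\<close>; otherwise \<open>f\<close> would return both \<open>0\<close> and
    \<open>1\<close>.\<close>
  then show False using diag reval_functional[of f "[?m]" 0 1] by auto
qed

end
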